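(* Let $(\mathcal{S},\mathfrak{S})$ be a measurable space and let $(M_{n},X_{n})_{n\in\mathbb{Z}}$ be a doubly infinite stationary Markov-modulated sequence of $\mathcal{S}\times\mathbb{R}^{d}$-valued random variables with ergodic driving chain $(M_n)_{n\in\mathbb{Z}}$. Let $(S_n)_{n\in\mathbb{Z}}$ be the associated doubly infinite random walk, $S_n=\sum_{i=1}^{n}X_i$ for $n\ge1$, $S_0=0$, $S_n=-\sum_{i=n+1}^{0}X_i$ for $n<0$. Then the following assertions are equivalent: (a) $(M_{n},S_{n})_{n\in\mathbb{Z}}$ is strict-sense null-homologous. (b) $(M_{n},S_{n})_{n\in\mathbb{Z}}$ is null-homologous and there is a measurable $g:\mathcal{S}\times\mathcal{S}\to\mathbb{R}^{d}$ such that $X_{n}=g(M_{n-1},M_{n})$ a.s. for each $n\in\mathbb{Z}$. (c) $(M_{n},S_{n})_{n\in\mathbb{Z}}$ is null-homologous. (d) $(S_{n})_{n\in\mathbb{Z}}$ is tight. (e) $(S_{n})_{n\ge 0}$ is tight.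
   Context: A doubly infinite stationary sequence $(M_{n},X_{n})_{n\in\mathbb{Z}}$ with values in $\mathcal{S}\times\mathbb{R}^{d}$ is Markov-modulated if: $(M_{n})_{n\in\mathbb{Z}}$ (the driving chain) is a temporally homogeneous Markov chain; the $X_{n}$, $n\in\mathbb{Z}$, are conditionally independent given $(M_{k})_{k\in\mathbb{Z}}$; and the conditional law of $X_{n}$ given $(M_{k})_{k\in\mathbb{Z}}$ is $P((M_{n-1},M_{n}),\cdot)$ for a stochastic kernel $P$ not depending on $n$. The driving chain is ergodic if the stationary sequence $(M_n)$ is ergodic. "a.s." refers to the underlying probability measure, under which the sequence is stationary. $(M_{n},S_{n})_{n\in\mathbb{Z}}$ is null-homologous if there exists a stationary sequence $(Y_{n})_{n\in\mathbb{Z}}$ of $\mathbb{R}^d$-valued random variables such that $X_{n}=Y_{n}-Y_{n-1}$ a.s. for all $n\in\mathbb{Z}$. It is strict-sense null-homologous if, furthermore, there exists a measurable function $\xi:\mathcal{S}\to\mathbb{R}^{d}$ such that $Y_{n}=\xi(M_{n})$ a.s. for all $n\ge 0$. A family of random variables is tight if the family of its laws is tight. *)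

theory Defs
  imports "HOL-Probability.Probability"
begin

text \<open>
  Throughout, \<open>\<Omega>\<close> is the underlying probability space and \<open>S\<close> a measurable space (a measure of
  which only \<open>space\<close> and \<open>sets\<close> are used). The space of doubly infinite sequences over \<open>S\<close> is the
  countable product \<open>\<Pi>\<^sub>M k\<in>UNIV. S\<close> over the index type \<^typ>\<open>int\<close>.
\<close>

definition random_seq :: "'w measure \<Rightarrow> 'a measure \<Rightarrow> (int \<Rightarrow> 'w \<Rightarrow> 'a) \<Rightarrow> bool" where
  "random_seq \<Omega> S Z \<longleftrightarrow> (\<forall>n. Z n \<in> \<Omega> \<rightarrow>\<^sub>M S)"

definition stationary_seq :: "'w measure \<Rightarrow> 'a measure \<Rightarrow> (int \<Rightarrow> 'w \<Rightarrow> 'a) \<Rightarrow> bool" where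
  "stationary_seq \<Omega> S Z \<longleftrightarrow> random_seq \<Omega> S Z \<and>
     (\<forall>k. distr \<Omega> (\<Pi>\<^sub>M n\<in>UNIV. S) (\<lambda>\<omega> n. Z (n + k) \<omega>)
        = distr \<Omega> (\<Pi>\<^sub>M n\<in>UNIV. S) (\<lambda>\<omega> n. Z n \<omega>))"

definition ergodic_seq :: "'w measure \<Rightarrow> 'a measure \<Rightarrow> (int \<Rightarrow> 'w \<Rightarrow> 'a) \<Rightarrow> bool" where
  "ergodic_seq \<Omega> S Z \<longleftrightarrow> stationary_seq \<Omega> S Z \<and>
     (\<forall>A\<in>sets (\<Pi>\<^sub>M n\<in>UNIV. S).
        {z \<in> space (\<Pi>\<^sub>M n\<in>UNIV. S). (\<lambda>n. z (n + 1)) \<in> A} = A \<longrightarrow>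
        measure (distr \<Omega> (\<Pi>\<^sub>M n\<in>UNIV. S) (\<lambda>\<omega> n. Z n \<omega>)) A \<in> {0, 1})"

text \<open>The sub-\<open>\<sigma>\<close>-algebra of \<open>\<Omega>\<close> generated by \<open>Z k\<close>, \<open>k \<in> I\<close>.\<close>

definition generated_by :: "'w measure \<Rightarrow> 'a measure \<Rightarrow> (int \<Rightarrow> 'w \<Rightarrow> 'a) \<Rightarrow> int set \<Rightarrow> 'w measure" where
  "generated_by \<Omega> S Z I =
     vimage_algebra (space \<Omega>) (\<lambda>\<omega>. \<lambda>k\<in>I. Z k \<omega>) (\<Pi>\<^sub>M k\<in>I. S)"

lemma subalgebra_generated_by:
  assumes "random_seq \<Omega> S Z"
  shows "subalgebra \<Omega> (generated_by \<Omega> S Z I)"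
proof -
  have "(\<lambda>\<omega>. \<lambda>k\<in>I. Z k \<omega>) \<in> \<Omega> \<rightarrow>\<^sub>M (\<Pi>\<^sub>M k\<in>I. S)"
    using assms unfolding random_seq_def by (intro measurable_restrict) auto
  then show ?thesis
    unfolding subalgebra_def generated_by_def
    using sets_image_in_sets[OF refl] by auto
qed

definition cond_probability :: "'w measure \<Rightarrow> 'w measure \<Rightarrow> 'w set \<Rightarrow> 'w \<Rightarrow> real" where
  "cond_probability \<Omega> F E = real_cond_exp \<Omega> F (indicator E)"

definition homogeneous_markov_chain :: "'w measure \<Rightarrow> 's measure \<Rightarrow> (int \<Rightarrow> 'w \<Rightarrow> 's) \<Rightarrow> bool" where
  "homogeneous_markov_chain \<Omega> S M \<longleftrightarrow> random_seq \<Omega> S M \<and>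
     (\<exists>Q \<in> S \<rightarrow>\<^sub>M prob_algebra S. \<forall>n. \<forall>B\<in>sets S.
        AE \<omega> in \<Omega>. cond_probability \<Omega> (generated_by \<Omega> S M {..n}) {\<omega> \<in> space \<Omega>. M (n + 1) \<omega> \<in> B} \<omega>
                    = measure (Q (M n \<omega>)) B)"

definition cond_indep_seq ::
    "'w measure \<Rightarrow> 'w measure \<Rightarrow> 'a measure \<Rightarrow> (int \<Rightarrow> 'w \<Rightarrow> 'a) \<Rightarrow> bool" where
  "cond_indep_seq \<Omega> F N X \<longleftrightarrow>
     (\<forall>J B. finite J \<longrightarrow> (\<forall>n\<in>J. B n \<in> sets N) \<longrightarrow>
        (AE \<omega> in \<Omega>. cond_probability \<Omega> F {\<omega> \<in> space \<Omega>. \<forall>n\<in>J. X n \<omega> \<in> B n} \<omega>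
                    = (\<Prod>n\<in>J. cond_probability \<Omega> F {\<omega> \<in> space \<Omega>. X n \<omega> \<in> B n} \<omega>)))"

definition markov_modulated ::
    "'w measure \<Rightarrow> 's measure \<Rightarrow> (int \<Rightarrow> 'w \<Rightarrow> 's) \<Rightarrow> (int \<Rightarrow> 'w \<Rightarrow> real ^ 'd) \<Rightarrow> bool" where
  "markov_modulated \<Omega> S M X \<longleftrightarrow>
     stationary_seq \<Omega> (S \<Otimes>\<^sub>M borel) (\<lambda>n \<omega>. (M n \<omega>, X n \<omega>)) \<and>
     homogeneous_markov_chain \<Omega> S M \<and>
     cond_indep_seq \<Omega> (generated_by \<Omega> S M UNIV) borel X \<and>
     (\<exists>P \<in> (S \<Otimes>\<^sub>M S) \<rightarrow>\<^sub>M prob_algebra borel. \<forall>n. \<forall>B\<in>sets borel.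
        AE \<omega> in \<Omega>. cond_probability \<Omega> (generated_by \<Omega> S M UNIV) {\<omega> \<in> space \<Omega>. X n \<omega> \<in> B} \<omega>
                    = measure (P (M (n - 1) \<omega>, M n \<omega>)) B)"

definition random_walk :: "(int \<Rightarrow> 'w \<Rightarrow> 'b::ab_group_add) \<Rightarrow> int \<Rightarrow> 'w \<Rightarrow> 'b" where
  "random_walk X n \<omega> = (if n \<ge> 0 then \<Sum>i=1..n. X i \<omega> else - (\<Sum>i=n+1..0. X i \<omega>))"

text \<open>
  Null homology of \<open>(M\<^sub>n, S\<^sub>n)\<close> is expressed through the increments \<open>X\<^sub>n\<close> of the walk. The sequence
  \<open>Y\<close> is required to be stationary on its own, not jointly with \<open>(M\<^sub>n, X\<^sub>n)\<close>.
\<close>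

definition coboundary_seq ::
    "'w measure \<Rightarrow> (int \<Rightarrow> 'w \<Rightarrow> real ^ 'd) \<Rightarrow> (int \<Rightarrow> 'w \<Rightarrow> real ^ 'd) \<Rightarrow> bool" where
  "coboundary_seq \<Omega> X Y \<longleftrightarrow> stationary_seq \<Omega> borel Y \<and>
     (\<forall>n. AE \<omega> in \<Omega>. X n \<omega> = Y n \<omega> - Y (n - 1) \<omega>)"

definition null_homologous :: "'w measure \<Rightarrow> (int \<Rightarrow> 'w \<Rightarrow> real ^ 'd) \<Rightarrow> bool" where
  "null_homologous \<Omega> X \<longleftrightarrow> (\<exists>Y. coboundary_seq \<Omega> X Y)"

definition strict_null_homologous ::
    "'w measure \<Rightarrow> 's measure \<Rightarrow> (int \<Rightarrow> 'w \<Rightarrow> 's) \<Rightarrow> (int \<Rightarrow> 'w \<Rightarrow> real ^ 'd) \<Rightarrow> bool" where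
  "strict_null_homologous \<Omega> S M X \<longleftrightarrow>
     (\<exists>Y. coboundary_seq \<Omega> X Y \<and>
        (\<exists>\<xi> \<in> S \<rightarrow>\<^sub>M borel. \<forall>n\<ge>0. AE \<omega> in \<Omega>. Y n \<omega> = \<xi> (M n \<omega>)))"

text \<open>
  The library constant \<^const>\<open>tight\<close> covers only sequences of laws on the real line.
\<close>

definition tight_laws :: "('b::t2_space) measure set \<Rightarrow> bool" where
  "tight_laws \<L> \<longleftrightarrow> (\<forall>\<epsilon>>0. \<exists>K. compact K \<and> (\<forall>\<mu>\<in>\<L>. measure \<mu> (- K) < \<epsilon>))"

definition tight_family ::
    "'w measure \<Rightarrow> 'i set \<Rightarrow> ('i \<Rightarrow> 'w \<Rightarrow> 'b::t2_space) \<Rightarrow> bool" where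
  "tight_family \<Omega> I Z \<longleftrightarrow> tight_laws ((\<lambda>i. distr \<Omega> borel (Z i)) ` I)"

end

theory Submission
  imports Defs
begin

text \<open>
  Only one implication has real content: tightness of \<open>(S\<^sub>n)\<close>, \<open>n \<ge> 0\<close>, produces a measurable
  \<open>\<xi>\<close> with \<open>X\<^sub>n = \<xi>(M\<^sub>n) - \<xi>(M\<^sub>n\<^sub>-\<^sub>1)\<close>. The others follow from the shift invariance of the joint
  law and from \<open>S\<^sub>n = Y\<^sub>n - Y\<^sub>0\<close>, in which all the \<open>Y\<^sub>n\<close> have one common law. As a vector is
  found coordinate by coordinate, let the walk be real.

  If such a \<open>\<xi>\<close> exists, every function \<open>h(a, s) = w(s - \<xi>(a))\<close> is invariant, that is,
  \<open>h(M\<^sub>0, s) = h(M\<^sub>1, s + X\<^sub>1)\<close>. Conversely, an invariant \<open>h\<close> for which \<open>h(a, \<cdot>)\<close> is a nonzero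
  element of \<open>L\<^sup>2(ds)\<close> gives back \<open>\<xi>(a)\<close> as the median of the measure \<open>h(a, s)\<^sup>2 ds\<close>, because
  medians move along with translations (\<open>increment_is_coboundary\<close>). Ergodicity ensures that
  \<open>h(M\<^sub>0, \<cdot>)\<close> is almost surely nonzero once it is nonzero with positive probability.

  The invariant function is found as an element of minimal norm (\<open>minimal_norm_invariant\<close>). Let
  \<open>K(a, \<cdot>)\<close> be the law of \<open>(M\<^sub>1, X\<^sub>1)\<close> given \<open>M\<^sub>0 = a\<close>. The operator
  \<open>V f (a, s) = \<integral> f(b, s + z) K(a, d(b, z))\<close> contracts the Hilbert space \<open>L\<^sup>2\<close> of the product of the
  law of \<open>M\<^sub>0\<close> and Lebesgue measure. It preserves the convex set of those functions \<open>f\<close> with values in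
  \<open>[0, 1]\<close> for which the integral over \<open>0 \<le> s \<le> 1\<close> of \<open>E f(M\<^sub>k, s + S\<^sub>k)\<close> is at least \<open>1/2\<close> for
  every \<open>k \<ge> 0\<close>; here the Markov property of \<open>(M\<^sub>k, S\<^sub>k)\<close> enters (\<open>nn_integral_step\<close>). Tightness
  says that the indicator of a large window in \<open>s\<close> belongs to this set
  (\<open>window_profile\<close>). By the parallelogram identity a sequence that minimises the norm in this set
  converges, the limit is not zero, and applying \<open>V\<close> cannot make its norm smaller. The norm
  is preserved only if no averaging takes place, which is the pathwise identity
  \<open>h(M\<^sub>0, s) = h(M\<^sub>1, s + X\<^sub>1)\<close> (\<open>exists_invariant_profile\<close>).

  That \<open>X\<^sub>1\<close> is a function of \<open>M\<^sub>0\<close> and \<open>M\<^sub>1\<close> comes out together with \<open>\<xi>\<close>: random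
  increments with a nondegenerate law given the chain would average \<open>h\<close> and lower its norm.
\<close>

section \<open>Invariant functions of minimal norm\<close>

text \<open>
  The maps \<open>a0\<close> and \<open>a1\<close> stand for the state before and after one step, and \<open>V f (a0 q)\<close> for the
  conditional expectation of \<open>f (a1 q)\<close> given \<open>a0 q\<close>; the assumption on integrals of squares is the
  conditional Jensen inequality for \<open>(f \<circ> a0 + f \<circ> a1)\<^sup>2\<close>. The parallelogram identity is applied twice to a
  minimising sequence. For two consecutive members it gives a geometric bound on their distance, hence
  almost everywhere convergence. For \<open>f \<circ> a0\<close> and \<open>f \<circ> a1\<close>, which have equal norm by
  stationarity, it bounds their squared distance by the excess of the squared norm over its minimum, since the Jensen
  inequality and \<open>(f + V f) / 2 \<in> C\<close> bound the norm of \<open>(f \<circ> a0 + f \<circ> a1) / 2\<close> from below.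
\<close>

lemma minimal_norm_invariant:
  fixes C :: "('b \<Rightarrow> real) set" and V :: "('b \<Rightarrow> real) \<Rightarrow> 'b \<Rightarrow> real"
  assumes a_meas [measurable]: "a0 \<in> \<Lambda> \<rightarrow>\<^sub>M N" "a1 \<in> \<Lambda> \<rightarrow>\<^sub>M N"
    and distr: "distr \<Lambda> N a1 = distr \<Lambda> N a0"
    and C_meas: "\<And>f. f \<in> C \<Longrightarrow> f \<in> borel_measurable N"
    and C_mid: "\<And>f g. f \<in> C \<Longrightarrow> g \<in> C \<Longrightarrow> (\<lambda>p. (f p + g p) / 2) \<in> C"
    and C_V: "\<And>f. f \<in> C \<Longrightarrow> V f \<in> C"
    and jensen: "\<And>f. f \<in> C \<Longrightarrow> (\<integral>\<^sup>+q. ennreal ((f (a0 q) + V f (a0 q))\<^sup>2) \<partial>\<Lambda>)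
                                 \<le> (\<integral>\<^sup>+q. ennreal ((f (a0 q) + f (a1 q))\<^sup>2) \<partial>\<Lambda>)"
    and f0: "f0 \<in> C" "(\<integral>\<^sup>+q. ennreal ((f0 (a0 q))\<^sup>2) \<partial>\<Lambda>) < \<infinity>"
  obtains f h where "\<forall>n::nat. f n \<in> C" "h \<in> borel_measurable N"
    "AE q in \<Lambda>. (\<lambda>n. f n (a0 q)) \<longlonglongrightarrow> h (a0 q)"
    "AE q in \<Lambda>. h (a0 q) = h (a1 q)" "(\<integral>\<^sup>+q. ennreal ((h (a0 q))\<^sup>2) \<partial>\<Lambda>) < \<infinity>"
proof -
  note C_meas [measurable]
  define L where "L f = (\<integral>\<^sup>+q. ennreal ((f (a0 q))\<^sup>2) \<partial>\<Lambda>)" for f :: "'b \<Rightarrow> real"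
  define m where "m = (INF f\<in>C. L f)"
  have m_le: "m \<le> L f" if "f \<in> C" for f
    unfolding m_def using that by (rule INF_lower)
  have m_fin: "m < \<infinity>"
    using m_le[OF f0(1)] f0(2) unfolding L_def by (rule le_less_trans)
  have transport: "(\<integral>\<^sup>+q. g (a1 q) \<partial>\<Lambda>) = (\<integral>\<^sup>+q. g (a0 q) \<partial>\<Lambda>)"
    if [measurable]: "g \<in> borel_measurable N" for g :: "'b \<Rightarrow> ennreal"
    using nn_integral_distr[of a1 \<Lambda> N g] nn_integral_distr[of a0 \<Lambda> N g] distr by simp
  \<comment> \<open>The form in which the parallelogram identity is used: a midpoint of squared norm at least \<open>m\<close>
    between points of squared norm at most \<open>m + e\<close> forces the points to be close.\<close>
  have cancel: "a \<le> ennreal (4 * e)"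
    if "a + 4 * b = 2 * c + 2 * d" "m \<le> b" "c \<le> m + ennreal e" "d \<le> m + ennreal e" "0 \<le> e"
    for a b c d :: ennreal and e :: real
  proof -
    have "4 * m + a \<le> 4 * b + a"
      using that(2) by (intro add_right_mono mult_left_mono) auto
    also have "\<dots> = 2 * c + 2 * d" using that(1) by (simp add: add.commute)
    also have "\<dots> \<le> 2 * (m + ennreal e) + 2 * (m + ennreal e)"
      using that by (intro add_mono mult_left_mono) auto
    also have "\<dots> = 4 * m + 4 * ennreal e"
      by (simp add: distrib_left ac_simps flip: mult_2 mult_2_right)
    finally show ?thesis
      using m_fin that(5) by (auto simp: ennreal_add_left_cancel_le ennreal_mult ennreal_mult_eq_top_iff)
  qed
  have "\<exists>f\<in>C. L f < m + ennreal ((1/8)^n)" for n :: nat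
  proof -
    have "m < m + ennreal ((1/8)^n)"
      using m_fin by (simp add: less_top[symmetric])
    then show ?thesis unfolding m_def INF_less_iff .
  qed
  then obtain f where f: "\<And>n. f n \<in> C" and Lf: "\<And>n::nat. L (f n) < m + ennreal ((1/8)^n)"
    by metis
  have [measurable]: "f n \<in> borel_measurable N" for n using f C_meas by auto
  have mid: "m \<le> L (\<lambda>p. (u p + v p) / 2)" if "u \<in> C" "v \<in> C" for u v
    using that by (intro m_le C_mid)
  have four: "ennreal ((x + y)\<^sup>2) = 4 * ennreal (((x + y) / 2)\<^sup>2)" for x y :: real
    by (simp add: power_divide flip: ennreal_numeral ennreal_mult)
  have two: "2 * ennreal (x\<^sup>2) = ennreal (2 * x\<^sup>2)" for x :: real
    by (simp flip: ennreal_numeral ennreal_mult)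
  have para: "ennreal ((x - y)\<^sup>2) + 4 * ennreal (((x + y) / 2)\<^sup>2) = 2 * ennreal (x\<^sup>2) + 2 * ennreal (y\<^sup>2)"
    for x y :: real
    unfolding four[symmetric] two
    by (simp flip: ennreal_plus) (simp add: power2_eq_square algebra_simps)
  have parallelogram: "(\<integral>\<^sup>+q. ennreal ((u q - v q)\<^sup>2) \<partial>\<Lambda>) + 4 * (\<integral>\<^sup>+q. ennreal (((u q + v q) / 2)\<^sup>2) \<partial>\<Lambda>)
       = 2 * (\<integral>\<^sup>+q. ennreal ((u q)\<^sup>2) \<partial>\<Lambda>) + 2 * (\<integral>\<^sup>+q. ennreal ((v q)\<^sup>2) \<partial>\<Lambda>)"
    if [measurable]: "u \<in> borel_measurable \<Lambda>" "v \<in> borel_measurable \<Lambda>" for u v :: "_ \<Rightarrow> real"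
    by (simp add: para flip: nn_integral_cmult nn_integral_add)

  have step: "(\<integral>\<^sup>+q. ennreal ((f n (a0 q) - f (Suc n) (a0 q))\<^sup>2) \<partial>\<Lambda>) \<le> ennreal (4 * (1/8)^n)" for n
  proof (rule cancel)
    show "(\<integral>\<^sup>+q. ennreal ((f n (a0 q) - f (Suc n) (a0 q))\<^sup>2) \<partial>\<Lambda>)
        + 4 * L (\<lambda>p. (f n p + f (Suc n) p) / 2) = 2 * L (f n) + 2 * L (f (Suc n))"
      unfolding L_def by (rule parallelogram) measurable
    show "m \<le> L (\<lambda>p. (f n p + f (Suc n) p) / 2)" by (intro mid f)
    show "L (f n) \<le> m + ennreal ((1/8)^n)" using Lf by (rule less_imp_le)
    have "L (f (Suc n)) \<le> m + ennreal ((1/8)^Suc n)" using Lf by (rule less_imp_le)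
    also have "\<dots> \<le> m + ennreal ((1/8)^n)" by (intro add_left_mono ennreal_leI) simp
    finally show "L (f (Suc n)) \<le> m + ennreal ((1/8)^n)" .
  qed simp
  have inv: "(\<integral>\<^sup>+q. ennreal ((f n (a0 q) - f n (a1 q))\<^sup>2) \<partial>\<Lambda>) \<le> ennreal (4 * (1/8)^n)" for n
  proof (rule cancel)
    have [measurable]: "V (f n) \<in> borel_measurable N" using f C_V C_meas by auto
    show "(\<integral>\<^sup>+q. ennreal ((f n (a0 q) - f n (a1 q))\<^sup>2) \<partial>\<Lambda>)
        + 4 * (\<integral>\<^sup>+q. ennreal (((f n (a0 q) + f n (a1 q)) / 2)\<^sup>2) \<partial>\<Lambda>) = 2 * L (f n) + 2 * L (f n)"
      unfolding L_def by (subst parallelogram) (simp_all add: transport[of "\<lambda>p. ennreal ((f n p)\<^sup>2)"])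
    have "4 * m \<le> 4 * L (\<lambda>p. (f n p + V (f n) p) / 2)"
      by (intro mult_left_mono mid f C_V) simp
    also have "\<dots> = (\<integral>\<^sup>+q. ennreal ((f n (a0 q) + V (f n) (a0 q))\<^sup>2) \<partial>\<Lambda>)"
      unfolding L_def four by (simp add: nn_integral_cmult)
    also have "\<dots> \<le> (\<integral>\<^sup>+q. ennreal ((f n (a0 q) + f n (a1 q))\<^sup>2) \<partial>\<Lambda>)"
      by (intro jensen f)
    also have "\<dots> = 4 * (\<integral>\<^sup>+q. ennreal (((f n (a0 q) + f n (a1 q)) / 2)\<^sup>2) \<partial>\<Lambda>)"
      unfolding four by (simp add: nn_integral_cmult)
    finally show "m \<le> (\<integral>\<^sup>+q. ennreal (((f n (a0 q) + f n (a1 q)) / 2)\<^sup>2) \<partial>\<Lambda>)"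
      by (simp add: ennreal_mult_le_mult_iff)
    show "L (f n) \<le> m + ennreal ((1/8)^n)" using Lf by (rule less_imp_le)
    show "L (f n) \<le> m + ennreal ((1/8)^n)" using Lf by (rule less_imp_le)
  qed simp

  \<comment> \<open>The weights \<open>4\<^sup>n\<close> are still summable against \<open>8\<^sup>-\<^sup>n\<close>, and a finite weighted sum of squares
    makes the terms themselves decay like \<open>2\<^sup>-\<^sup>n\<close>.\<close>
  have ae_small: "AE q in \<Lambda>. \<exists>c. \<forall>n. \<bar>g n q\<bar> \<le> c * (1/2)^n"
    if [measurable]: "\<And>n. g n \<in> borel_measurable \<Lambda>"
      and le: "\<And>n. (\<integral>\<^sup>+q. ennreal ((g n q)\<^sup>2) \<partial>\<Lambda>) \<le> ennreal (4 * (1/8)^n)"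
    for g :: "nat \<Rightarrow> _ \<Rightarrow> real"
  proof -
    have "(\<integral>\<^sup>+q. (\<Sum>n. ennreal (4^n * (g n q)\<^sup>2)) \<partial>\<Lambda>) = (\<Sum>n. \<integral>\<^sup>+q. ennreal (4^n * (g n q)\<^sup>2) \<partial>\<Lambda>)"
      by (rule nn_integral_suminf) measurable
    also have "\<dots> \<le> (\<Sum>n. ennreal (4 * (1/2)^n))"
    proof (intro suminf_le summableI)
      fix n
      have "(\<integral>\<^sup>+q. ennreal (4^n * (g n q)\<^sup>2) \<partial>\<Lambda>) = ennreal (4^n) * (\<integral>\<^sup>+q. ennreal ((g n q)\<^sup>2) \<partial>\<Lambda>)"
        by (simp add: ennreal_mult nn_integral_cmult)
      also have "\<dots> \<le> ennreal (4^n) * ennreal (4 * (1/8)^n)"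
        by (intro mult_left_mono le) simp
      also have "\<dots> = ennreal (4 * (1/2)^n)"
        using power_mult_distrib[of "4::real" 2 n] by (simp add: power_divide flip: ennreal_mult)
      finally show "(\<integral>\<^sup>+q. ennreal (4^n * (g n q)\<^sup>2) \<partial>\<Lambda>) \<le> ennreal (4 * (1/2)^n)" .
    qed
    also have "\<dots> < \<infinity>"
      by (subst suminf_ennreal2) (auto intro!: summable_mult simp: complete_algebra_summable_geometric)
    finally have "(\<integral>\<^sup>+q. (\<Sum>n. ennreal (4^n * (g n q)\<^sup>2)) \<partial>\<Lambda>) \<noteq> \<infinity>" by simp
    then have "AE q in \<Lambda>. (\<Sum>n. ennreal (4^n * (g n q)\<^sup>2)) \<noteq> \<infinity>"
      by (intro nn_integral_noteq_infinite) measurable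
    then show ?thesis
    proof eventually_elim
      case (elim q)
      define c where "c = enn2real (\<Sum>n. ennreal (4^n * (g n q)\<^sup>2))"
      have c: "(\<Sum>n. ennreal (4^n * (g n q)\<^sup>2)) = ennreal c" "0 \<le> c"
        unfolding c_def using elim
        by (simp_all only: infinity_ennreal_def less_top ennreal_enn2real enn2real_nonneg)
      have "\<bar>g n q\<bar> \<le> sqrt c * (1/2)^n" for n
      proof -
        have "ennreal (4^n * (g n q)\<^sup>2) = (\<Sum>i\<in>{n}. ennreal (4^i * (g i q)\<^sup>2))" by simp
        also have "\<dots> \<le> ennreal c"
          unfolding c(1)[symmetric] by (rule sum_le_suminf) auto
        finally have "4^n * (g n q)\<^sup>2 \<le> c" using c(2) by simp
        moreover have "4^n * (g n q)\<^sup>2 = (2^n * \<bar>g n q\<bar>)\<^sup>2"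
          using power_mult_distrib[of "2::real" 2 n] by (simp add: power_mult_distrib power2_eq_square)
        ultimately have "2^n * \<bar>g n q\<bar> \<le> sqrt c"
          by (simp add: real_le_rsqrt)
        then show ?thesis by (simp add: field_simps power_divide)
      qed
      then show ?case by blast
    qed
  qed
  have geometric: "(\<lambda>n. c * (1/2)^n) \<longlonglongrightarrow> (0::real)" for c
    by (intro tendsto_mult_right_zero LIMSEQ_power_zero) simp

  define h where "h p = lim (\<lambda>n. f n p)" for p
  have [measurable]: "h \<in> borel_measurable N" unfolding h_def by measurable
  have conv0: "AE q in \<Lambda>. convergent (\<lambda>n. f n (a0 q))"
  proof -
    have "AE q in \<Lambda>. \<exists>c. \<forall>n. \<bar>f n (a0 q) - f (Suc n) (a0 q)\<bar> \<le> c * (1/2)^n"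
      by (rule ae_small) (use step in auto)
    then show ?thesis
    proof eventually_elim
      case (elim q)
      then obtain c where c: "\<bar>f n (a0 q) - f (Suc n) (a0 q)\<bar> \<le> c * (1/2)^n" for n by blast
      have "summable (\<lambda>n. f (Suc n) (a0 q) - f n (a0 q))"
      proof (rule summable_comparison_test')
        show "summable (\<lambda>n. c * (1/2::real)^n)" by (intro summable_mult) simp
        show "norm (f (Suc n) (a0 q) - f n (a0 q)) \<le> c * (1/2)^n" if "0 \<le> n" for n
          using c[of n] by (simp add: abs_minus_commute)
      qed
      then show ?case
        by (simp add: summable_iff_convergent sum_lessThan_telescope[of "\<lambda>n. f n (a0 q)"]
            convergent_diff_const_right_iff)
    qed
  qed
  \<comment> \<open>Convergence at \<open>a1 q\<close> comes from equality of the two laws.\<close>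
  have conv1: "AE q in \<Lambda>. convergent (\<lambda>n. f n (a1 q))"
  proof -
    have [measurable]: "Measurable.pred N (\<lambda>p. convergent (\<lambda>n. f n p))"
      unfolding Cauchy_convergent_iff[symmetric] by measurable
    have "AE p in distr \<Lambda> N a0. convergent (\<lambda>n. f n p)"
      using conv0 by (subst AE_distr_iff) auto
    then show ?thesis
      unfolding distr[symmetric] by (subst (asm) AE_distr_iff) auto
  qed
  have lim0: "AE q in \<Lambda>. (\<lambda>n. f n (a0 q)) \<longlonglongrightarrow> h (a0 q)"
    using conv0 unfolding h_def by (simp add: convergent_LIMSEQ_iff)
  have invariant: "AE q in \<Lambda>. h (a0 q) = h (a1 q)"
  proof -
    have "AE q in \<Lambda>. \<exists>c. \<forall>n. \<bar>f n (a0 q) - f n (a1 q)\<bar> \<le> c * (1/2)^n"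
      by (rule ae_small) (use inv in auto)
    then show ?thesis using conv0 conv1
    proof eventually_elim
      case (elim q)
      then obtain c where c: "\<bar>f n (a0 q) - f n (a1 q)\<bar> \<le> c * (1/2)^n" for n by blast
      have "(\<lambda>n. f n (a0 q) - f n (a1 q)) \<longlonglongrightarrow> 0"
        by (rule Lim_null_comparison[OF _ geometric[of c]]) (use c in auto)
      moreover have "(\<lambda>n. f n (a0 q) - f n (a1 q)) \<longlonglongrightarrow> h (a0 q) - h (a1 q)"
        using elim(2,3) unfolding h_def by (intro tendsto_diff) (auto simp: convergent_LIMSEQ_iff)
      ultimately show ?case using LIMSEQ_unique by fastforce
    qed
  qed
  have "(\<integral>\<^sup>+q. ennreal ((h (a0 q))\<^sup>2) \<partial>\<Lambda>) = (\<integral>\<^sup>+q. liminf (\<lambda>n. ennreal ((f n (a0 q))\<^sup>2)) \<partial>\<Lambda>)"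
    by (rule nn_integral_cong_AE, use lim0 in eventually_elim)
       (metis lim_imp_Liminf sequentially_bot tendsto_ennrealI tendsto_power)
  also have "\<dots> \<le> liminf (\<lambda>n. L (f n))"
    unfolding L_def by (rule nn_integral_liminf) measurable
  also have "\<dots> \<le> m + 1"
  proof (rule Liminf_le)
    show "\<forall>\<^sub>F n in sequentially. L (f n) \<le> m + 1"
    proof (intro always_eventually allI)
      fix n show "L (f n) \<le> m + 1"
        using less_imp_le[OF Lf[of n]] by (rule order_trans) (auto intro!: add_left_mono simp: power_le_one)
    qed
  qed simp
  also have "\<dots> < \<infinity>" using m_fin by (simp add: less_top)
  finally have "(\<integral>\<^sup>+q. ennreal ((h (a0 q))\<^sup>2) \<partial>\<Lambda>) < \<infinity>" .
  with f lim0 invariant show ?thesis by (intro that[of f h]) auto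
qed

section \<open>Medians of finite measures on the line\<close>

definition lower_median :: "real measure \<Rightarrow> real" where
  "lower_median \<mu> = Inf {u. measure \<mu> (space \<mu>) \<le> 2 * measure \<mu> {..u}}"

lemma
  assumes \<mu>: "finite_borel_measure \<mu>" and pos: "0 < measure \<mu> (space \<mu>)"
  shows lower_median_nonempty: "{u. measure \<mu> (space \<mu>) \<le> 2 * measure \<mu> {..u}} \<noteq> {}"
    and lower_median_bdd_below: "bdd_below {u. measure \<mu> (space \<mu>) \<le> 2 * measure \<mu> {..u}}"
proof -
  interpret finite_borel_measure \<mu> by fact
  have "\<forall>\<^sub>F u in at_top. measure \<mu> (space \<mu>) / 2 < cdf \<mu> u"
    using pos by (intro order_tendstoD(1)[OF cdf_lim_at_top]) simp
  then obtain u where "measure \<mu> (space \<mu>) / 2 < cdf \<mu> u"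
    by (auto simp: eventually_at_top_linorder)
  then have "u \<in> {u. measure \<mu> (space \<mu>) \<le> 2 * measure \<mu> {..u}}"
    by (simp add: cdf_def)
  then show "{u. measure \<mu> (space \<mu>) \<le> 2 * measure \<mu> {..u}} \<noteq> {}" by blast
  have "\<forall>\<^sub>F u in at_bot. cdf \<mu> u < measure \<mu> (space \<mu>) / 2"
    using pos by (intro order_tendstoD(2)[OF cdf_lim_at_bot]) simp
  then obtain v where v: "\<And>u. u \<le> v \<Longrightarrow> cdf \<mu> u < measure \<mu> (space \<mu>) / 2"
    by (auto simp: eventually_at_bot_linorder)
  show "bdd_below {u. measure \<mu> (space \<mu>) \<le> 2 * measure \<mu> {..u}}"
  proof (rule bdd_belowI)
    fix u assume "u \<in> {u. measure \<mu> (space \<mu>) \<le> 2 * measure \<mu> {..u}}"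
    then show "v \<le> u" using v[of u] by (cases "u \<le> v") (auto simp: cdf_def)
  qed
qed

text \<open>
  The level set of the median is described by countably many values of the distribution function, which
  makes the median of a measurable family of measures measurable.
\<close>

lemma lower_median_less_iff:
  assumes \<mu>: "finite_borel_measure \<mu>" and pos: "0 < measure \<mu> (space \<mu>)"
  shows "lower_median \<mu> < c \<longleftrightarrow>
    (\<exists>q::rat. of_rat q < c \<and> measure \<mu> (space \<mu>) \<le> 2 * measure \<mu> {..of_rat q})"
proof -
  interpret finite_borel_measure \<mu> by fact
  have "lower_median \<mu> < c \<longleftrightarrow> (\<exists>u<c. measure \<mu> (space \<mu>) \<le> 2 * measure \<mu> {..u})"
    unfolding lower_median_def
    by (subst cInf_less_iff[OF lower_median_nonempty[OF assms] lower_median_bdd_below[OF assms]]) auto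
  also have "\<dots> \<longleftrightarrow> (\<exists>q::rat. of_rat q < c \<and> measure \<mu> (space \<mu>) \<le> 2 * measure \<mu> {..of_rat q})"
  proof safe
    fix u assume u: "u < c" "measure \<mu> (space \<mu>) \<le> 2 * measure \<mu> {..u}"
    obtain q where q: "u < of_rat q" "of_rat q < c" using of_rat_dense[OF u(1)] by blast
    have "measure \<mu> {..u} \<le> measure \<mu> {..of_rat q}"
      using cdf_nondecreasing[of u "of_rat q"] q(1) by (simp add: cdf_def)
    with u(2) q(2) show "\<exists>q::rat. of_rat q < c \<and> measure \<mu> (space \<mu>) \<le> 2 * measure \<mu> {..of_rat q}"
      by (intro exI[of _ q]) auto
  qed blast
  finally show ?thesis .
qed

lemma lower_median_shift:
  assumes \<mu>: "finite_borel_measure \<mu>" and pos: "0 < measure \<mu> (space \<mu>)"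
    and total: "measure \<nu> (space \<nu>) = measure \<mu> (space \<mu>)"
    and shift: "\<And>u. measure \<nu> {..u + c} = measure \<mu> {..u}"
  shows "lower_median \<nu> = lower_median \<mu> + c"
proof -
  let ?U = "{u. measure \<mu> (space \<mu>) \<le> 2 * measure \<mu> {..u}}"
  have "measure \<nu> {..u} = measure \<mu> {..u - c}" for u using shift[of "u - c"] by simp
  then have "{u. measure \<nu> (space \<nu>) \<le> 2 * measure \<nu> {..u}} = (\<lambda>u. u + c) ` ?U"
    unfolding total by (auto simp: image_iff intro!: exI[of _ "_ - c"])
  moreover have "Inf ((\<lambda>u. u + c) ` ?U) = Inf ?U + c"
    by (subst continuous_at_Inf_mono[of "\<lambda>u. u + c" ?U])
       (use lower_median_nonempty[OF \<mu> pos] lower_median_bdd_below[OF \<mu> pos] in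
          \<open>auto simp: mono_def intro!: continuous_intros\<close>)
  ultimately show ?thesis unfolding lower_median_def by simp
qed

section \<open>Kernels and conditional probabilities\<close>

text \<open>
  The defining property of a regular conditional law, extended from rectangles over intersection-stable
  generators to all nonnegative functions. The kernel is a function of \<open>\<omega>\<close> rather than of \<open>X \<omega>\<close>, so the
  same lemma serves when \<open>X\<close> is the identity into a sub-\<open>\<sigma>\<close>-algebra and when \<open>X\<close> is a pair.
\<close>

lemma nn_integral_kernel_generator:
  assumes X [measurable]: "X \<in> \<Omega> \<rightarrow>\<^sub>M F" and Y [measurable]: "Y \<in> \<Omega> \<rightarrow>\<^sub>M N"
    and K: "K \<in> \<Omega> \<rightarrow>\<^sub>M prob_algebra N"
    and \<Omega>: "prob_space \<Omega>"
    and F: "sets F = sigma_sets (space F) E" "Int_stable E" "E \<subseteq> Pow (space F)" "space F \<in> E"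
    and N: "sets N = sigma_sets (space N) H" "Int_stable H" "H \<subseteq> Pow (space N)" "space N \<in> H"
    and rect: "\<And>A B. A \<in> E \<Longrightarrow> B \<in> H \<Longrightarrow>
      emeasure \<Omega> {\<omega> \<in> space \<Omega>. X \<omega> \<in> A \<and> Y \<omega> \<in> B} = (\<integral>\<^sup>+\<omega>. indicator A (X \<omega>) * emeasure (K \<omega>) B \<partial>\<Omega>)"
    and G: "G \<in> borel_measurable (F \<Otimes>\<^sub>M N)"
  shows "(\<integral>\<^sup>+\<omega>. G (X \<omega>, Y \<omega>) \<partial>\<Omega>) = (\<integral>\<^sup>+\<omega>. \<integral>\<^sup>+y. G (X \<omega>, y) \<partial>K \<omega> \<partial>\<Omega>)"
proof -
  interpret prob_space \<Omega> by fact
  note [measurable] = G K measurable_prob_algebraD[OF K]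
  define L where "L \<omega> = distr (K \<omega>) (F \<Otimes>\<^sub>M N) (\<lambda>y. (X \<omega>, y))" for \<omega>
  have L [measurable]: "L \<in> \<Omega> \<rightarrow>\<^sub>M prob_algebra (F \<Otimes>\<^sub>M N)"
    unfolding L_def by (rule measurable_distr_prob_space2[OF K]) measurable
  have L' [measurable]: "L \<in> \<Omega> \<rightarrow>\<^sub>M subprob_algebra (F \<Otimes>\<^sub>M N)"
    using L by (rule measurable_prob_algebraD)
  have sets_K: "sets (K \<omega>) = sets N" if "\<omega> \<in> space \<Omega>" for \<omega>
    using measurable_space[OF K that] by (simp add: space_prob_algebra)
  have pair_in: "(\<lambda>y. (X \<omega>, y)) \<in> K \<omega> \<rightarrow>\<^sub>M F \<Otimes>\<^sub>M N" if "\<omega> \<in> space \<Omega>" for \<omega>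
    using measurable_space[OF X that] by (subst measurable_cong_sets[OF sets_K[OF that] refl]) measurable
  let ?R = "{a \<times> b | a b. a \<in> E \<and> b \<in> H}"
  have E_sets: "A \<in> sets F" if "A \<in> E" for A using that F(1) by auto
  have H_sets: "B \<in> sets N" if "B \<in> H" for B using that N(1) by auto
  have gen: "sets (F \<Otimes>\<^sub>M N) = sigma_sets (space F \<times> space N) ?R"
  proof -
    have "sets (F \<Otimes>\<^sub>M N) = sets (sigma (space F \<times> space N) ?R)"
      using F N by (intro sets_pair_eq[where Ca="{space F}" and Cb="{space N}"]) auto
    also have "\<dots> = sigma_sets (space F \<times> space N) ?R"
      using F(3) N(3) by (intro sets_measure_of) auto
    finally show ?thesis .
  qed
  have eq: "distr \<Omega> (F \<Otimes>\<^sub>M N) (\<lambda>\<omega>. (X \<omega>, Y \<omega>)) = \<Omega> \<bind> L"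
  proof (rule measure_eqI_generator_eq[where E="?R" and \<Omega>="space F \<times> space N" and A="\<lambda>_. space F \<times> space N"])
    show "Int_stable ?R"
    proof (rule Int_stableI)
      fix p q assume "p \<in> ?R" "q \<in> ?R"
      then obtain a b c d where "p = a \<times> b" "q = c \<times> d" "a \<in> E" "b \<in> H" "c \<in> E" "d \<in> H" by blast
      then have "p \<inter> q = (a \<inter> c) \<times> (b \<inter> d)" "a \<inter> c \<in> E" "b \<inter> d \<in> H"
        using Int_stableD[OF F(2)] Int_stableD[OF N(2)] by auto
      then show "p \<inter> q \<in> ?R" by blast
    qed
    show "?R \<subseteq> Pow (space F \<times> space N)" using F(3) N(3) by blast
    show "sets (distr \<Omega> (F \<Otimes>\<^sub>M N) (\<lambda>\<omega>. (X \<omega>, Y \<omega>))) = sigma_sets (space F \<times> space N) ?R"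
      using gen by simp
    show "sets (\<Omega> \<bind> L) = sigma_sets (space F \<times> space N) ?R"
      using gen sets_bind[OF subprob_measurableD(2)[OF L'] not_empty] by simp
    show "emeasure (distr \<Omega> (F \<Otimes>\<^sub>M N) (\<lambda>\<omega>. (X \<omega>, Y \<omega>))) R = emeasure (\<Omega> \<bind> L) R" if "R \<in> ?R" for R
    proof -
      from that obtain A B where R: "R = A \<times> B" and AB: "A \<in> E" "B \<in> H" by blast
      note [measurable] = E_sets[OF AB(1)] H_sets[OF AB(2)]
      have "emeasure (distr \<Omega> (F \<Otimes>\<^sub>M N) (\<lambda>\<omega>. (X \<omega>, Y \<omega>))) R = emeasure \<Omega> {\<omega> \<in> space \<Omega>. X \<omega> \<in> A \<and> Y \<omega> \<in> B}"
        unfolding R by (subst emeasure_distr) (auto intro!: arg_cong[where f="emeasure \<Omega>"])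
      also have "\<dots> = (\<integral>\<^sup>+\<omega>. indicator A (X \<omega>) * emeasure (K \<omega>) B \<partial>\<Omega>)" by (rule rect[OF AB])
      also have "\<dots> = (\<integral>\<^sup>+\<omega>. emeasure (L \<omega>) R \<partial>\<Omega>)"
      proof (rule nn_integral_cong)
        fix \<omega> assume \<omega>: "\<omega> \<in> space \<Omega>"
        have "emeasure (L \<omega>) R = emeasure (K \<omega>) ((\<lambda>y. (X \<omega>, y)) -` R \<inter> space (K \<omega>))"
          unfolding L_def using pair_in[OF \<omega>] by (rule emeasure_distr) (simp add: R)
        also have "(\<lambda>y. (X \<omega>, y)) -` R \<inter> space (K \<omega>) = (if X \<omega> \<in> A then B else {})"
          using sets_eq_imp_space_eq[OF sets_K[OF \<omega>]] sets.sets_into_space[OF H_sets[OF AB(2)]] by (auto simp: R)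
        finally show "indicator A (X \<omega>) * emeasure (K \<omega>) B = emeasure (L \<omega>) R" by simp
      qed
      also have "\<dots> = emeasure (\<Omega> \<bind> L) R"
        by (rule emeasure_bind[OF not_empty L', symmetric]) (simp add: R)
      finally show ?thesis .
    qed
    show "range (\<lambda>_. space F \<times> space N) \<subseteq> ?R" using F(4) N(4) by blast
    show "emeasure (distr \<Omega> (F \<Otimes>\<^sub>M N) (\<lambda>\<omega>. (X \<omega>, Y \<omega>))) (space F \<times> space N) \<noteq> \<infinity>"
      by (simp add: emeasure_distr)
  qed auto
  have "(\<integral>\<^sup>+\<omega>. G (X \<omega>, Y \<omega>) \<partial>\<Omega>) = (\<integral>\<^sup>+p. G p \<partial>distr \<Omega> (F \<Otimes>\<^sub>M N) (\<lambda>\<omega>. (X \<omega>, Y \<omega>)))"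
    by (simp add: nn_integral_distr)
  also have "\<dots> = (\<integral>\<^sup>+\<omega>. \<integral>\<^sup>+p. G p \<partial>L \<omega> \<partial>\<Omega>)"
    unfolding eq by (rule nn_integral_bind[OF G L'])
  also have "\<dots> = (\<integral>\<^sup>+\<omega>. \<integral>\<^sup>+y. G (X \<omega>, y) \<partial>K \<omega> \<partial>\<Omega>)"
    by (intro nn_integral_cong) (simp add: L_def nn_integral_distr[OF pair_in])
  finally show ?thesis .
qed

lemma measurable_generated_by:
  assumes "random_seq \<Omega> S Z" "k \<in> I"
  shows "Z k \<in> generated_by \<Omega> S Z I \<rightarrow>\<^sub>M S"
proof -
  have "(\<lambda>\<omega>. \<lambda>k\<in>I. Z k \<omega>) \<in> generated_by \<Omega> S Z I \<rightarrow>\<^sub>M (\<Pi>\<^sub>M k\<in>I. S)"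
    unfolding generated_by_def
  proof (rule measurable_vimage_algebra1)
    have Z: "Z j \<in> \<Omega> \<rightarrow>\<^sub>M S" for j using assms(1) by (simp add: random_seq_def)
    then show "(\<lambda>\<omega>. \<lambda>k\<in>I. Z k \<omega>) \<in> space \<Omega> \<rightarrow> space (\<Pi>\<^sub>M k\<in>I. S)"
      by (auto simp: space_PiM intro: measurable_space[OF Z])
  qed
  from measurable_compose[OF this measurable_component_singleton[OF assms(2)]]
  show ?thesis using assms(2) by simp
qed

text \<open>
  Every later use of conditional probabilities passes through this identity between unconditional
  integrals.
\<close>

lemma nn_integral_cond_probability:
  assumes "prob_space \<Omega>" and sub: "subalgebra \<Omega> F"
    and u: "u \<in> borel_measurable F" "\<And>\<omega>. 0 \<le> u \<omega>" "\<And>\<omega>. \<omega> \<in> space \<Omega> \<Longrightarrow> u \<omega> \<le> 1"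
    and E: "E \<in> sets \<Omega>"
    and p: "p \<in> borel_measurable \<Omega>" "\<And>\<omega>. 0 \<le> p \<omega>" "AE \<omega> in \<Omega>. cond_probability \<Omega> F E \<omega> = p \<omega>"
  shows "(\<integral>\<^sup>+\<omega>. ennreal (u \<omega>) * indicator E \<omega> \<partial>\<Omega>) = (\<integral>\<^sup>+\<omega>. ennreal (u \<omega>) * ennreal (p \<omega>) \<partial>\<Omega>)"
proof -
  interpret prob_space \<Omega> by fact
  interpret finite_measure_subalgebra \<Omega> F by standard (rule sub)
  note [measurable] = E p(1) measurable_from_subalg[OF sub u(1)]
  have int: "integrable \<Omega> (\<lambda>\<omega>. u \<omega> * indicator E \<omega>)"
    using u(2,3) by (intro integrable_const_bound[where B=1]) (auto simp: indicator_def)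
  have E_real: "(indicator E :: _ \<Rightarrow> real) \<in> borel_measurable \<Omega>" by measurable
  note * = real_cond_exp_intg_fpos[OF int u(2) u(1) E_real]
  have ae: "AE \<omega> in \<Omega>. u \<omega> * real_cond_exp \<Omega> F (indicator E) \<omega> = u \<omega> * p \<omega>"
    using p(3) by (auto simp: cond_probability_def)
  have int': "integrable \<Omega> (\<lambda>\<omega>. u \<omega> * p \<omega>)"
    by (rule integrable_cong_AE_imp[OF *(1) _ ae]) measurable
  have "(\<integral>\<^sup>+\<omega>. ennreal (u \<omega>) * indicator E \<omega> \<partial>\<Omega>) = (\<integral>\<^sup>+\<omega>. ennreal (u \<omega> * indicator E \<omega>) \<partial>\<Omega>)"
    by (intro nn_integral_cong) (auto simp: indicator_def)
  also have "\<dots> = ennreal (\<integral>\<omega>. u \<omega> * indicator E \<omega> \<partial>\<Omega>)"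
    using u(2) by (intro nn_integral_eq_integral[OF int]) auto
  also have "(\<integral>\<omega>. u \<omega> * indicator E \<omega> \<partial>\<Omega>) = (\<integral>\<omega>. u \<omega> * p \<omega> \<partial>\<Omega>)"
    unfolding *(2)[symmetric] using ae by (intro integral_cong_AE) auto
  also have "ennreal (\<integral>\<omega>. u \<omega> * p \<omega> \<partial>\<Omega>) = (\<integral>\<^sup>+\<omega>. ennreal (u \<omega> * p \<omega>) \<partial>\<Omega>)"
    using u(2) p(2) by (intro nn_integral_eq_integral[OF int', symmetric]) auto
  also have "\<dots> = (\<integral>\<^sup>+\<omega>. ennreal (u \<omega>) * ennreal (p \<omega>) \<partial>\<Omega>)"
    using u(2) p(2) by (simp add: ennreal_mult)
  finally show ?thesis .
qed

section \<open>The Markov property of a modulated walk\<close>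

text \<open>
  In the application \<open>x\<close> is one coordinate of the increments. The kernels are parameters because the
  transition kernel \<open>K\<close> and the operator \<open>V\<close> below are built from them.
\<close>

locale modulated_walk = prob_space \<Omega> for \<Omega> :: "'w measure" +
  fixes S :: "'s measure" and M :: "int \<Rightarrow> 'w \<Rightarrow> 's" and x :: "int \<Rightarrow> 'w \<Rightarrow> real"
    and Q :: "'s \<Rightarrow> 's measure" and P :: "'s \<times> 's \<Rightarrow> real measure"
  assumes M [measurable]: "\<And>n. M n \<in> \<Omega> \<rightarrow>\<^sub>M S" and x [measurable]: "\<And>n. x n \<in> borel_measurable \<Omega>"
    and Q: "Q \<in> S \<rightarrow>\<^sub>M prob_algebra S"
    and markov: "\<And>n B. B \<in> sets S \<Longrightarrow>
      AE \<omega> in \<Omega>. cond_probability \<Omega> (generated_by \<Omega> S M {..n}) {\<omega> \<in> space \<Omega>. M (n + 1) \<omega> \<in> B} \<omega>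
        = measure (Q (M n \<omega>)) B"
    and P: "P \<in> S \<Otimes>\<^sub>M S \<rightarrow>\<^sub>M prob_algebra borel"
    and indep: "cond_indep_seq \<Omega> (generated_by \<Omega> S M UNIV) borel x"
    and law: "\<And>n B. B \<in> sets borel \<Longrightarrow>
      AE \<omega> in \<Omega>. cond_probability \<Omega> (generated_by \<Omega> S M UNIV) {\<omega> \<in> space \<Omega>. x n \<omega> \<in> B} \<omega>
        = measure (P (M (n - 1) \<omega>, M n \<omega>)) B"
begin

text \<open>
  The law of the next state and the next increment, given the present state.
\<close>

definition K :: "'s \<Rightarrow> ('s \<times> real) measure" where
  "K a = Q a \<bind> (\<lambda>b. distr (P (a, b)) (S \<Otimes>\<^sub>M borel) (\<lambda>z. (b, z)))"

definition T :: "nat \<Rightarrow> 'w \<Rightarrow> real" where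
  "T k \<omega> = (\<Sum>i=1..int k. x i \<omega>)"

lemma T_0 [simp]: "T 0 \<omega> = 0" and T_Suc: "T (Suc k) \<omega> = T k \<omega> + x (int k + 1) \<omega>"
proof -
  show "T 0 \<omega> = 0" by (simp add: T_def)
  have "{1..int (Suc k)} = insert (int k + 1) {1..int k}" by auto
  then show "T (Suc k) \<omega> = T k \<omega> + x (int k + 1) \<omega>" by (simp add: T_def)
qed

lemma measurable_T [measurable]: "T k \<in> borel_measurable \<Omega>"
  unfolding T_def by measurable

lemma random_seq_M: "random_seq \<Omega> S M"
  using M by (simp add: random_seq_def)

lemma QP_measurable:
  "Q \<in> S \<rightarrow>\<^sub>M subprob_algebra S" "P \<in> S \<Otimes>\<^sub>M S \<rightarrow>\<^sub>M subprob_algebra borel"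
  using Q P by (auto intro: measurable_prob_algebraD)

lemma K_kernel: "K \<in> S \<rightarrow>\<^sub>M prob_algebra (S \<Otimes>\<^sub>M borel)"
proof -
  note [measurable] = Q P
  have "(\<lambda>(a, b). distr (P (a, b)) (S \<Otimes>\<^sub>M borel) (\<lambda>z. (b, z))) \<in> S \<Otimes>\<^sub>M S \<rightarrow>\<^sub>M prob_algebra (S \<Otimes>\<^sub>M borel)"
    unfolding case_prod_beta by (rule measurable_distr_prob_space2[where M=borel]) measurable
  then show ?thesis
    unfolding K_def by (intro measurable_bind_prob_space2[OF Q])
qed

lemma measurable_K [measurable]: "K \<in> S \<rightarrow>\<^sub>M subprob_algebra (S \<Otimes>\<^sub>M borel)"
  using K_kernel by (rule measurable_prob_algebraD)

lemma measurable_P [measurable (raw)]: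
  assumes "f \<in> N \<rightarrow>\<^sub>M S" "g \<in> N \<rightarrow>\<^sub>M S" "B \<in> sets borel"
  shows "(\<lambda>\<omega>. measure (P (f \<omega>, g \<omega>)) B) \<in> borel_measurable N"
  using measurable_compose[OF measurable_Pair[OF assms(1,2)] P]
  by (rule measurable_compose) (rule measurable_measure_prob_algebra[OF assms(3)])

lemma
  assumes "a \<in> space S"
  shows prob_space_K: "prob_space (K a)" and sets_K: "sets (K a) = sets (S \<Otimes>\<^sub>M borel)"
    and prob_space_Q: "prob_space (Q a)" and sets_Q: "sets (Q a) = sets S"
  using measurable_space[OF K_kernel assms] measurable_space[OF Q assms] by (auto simp: space_prob_algebra)

lemma emeasure_K_rectangle:
  assumes a: "a \<in> space S" and A: "A \<in> sets S" and B: "B \<in> sets borel"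
  shows "emeasure (K a) (A \<times> B) = (\<integral>\<^sup>+b. indicator A b * ennreal (measure (P (a, b)) B) \<partial>Q a)"
proof -
  note [measurable] = P a A B
  interpret Q: prob_space "Q a" by (rule prob_space_Q[OF a])
  have PD: "(\<lambda>b. distr (P (a, b)) (S \<Otimes>\<^sub>M borel) (\<lambda>z. (b, z))) \<in> S \<rightarrow>\<^sub>M prob_algebra (S \<Otimes>\<^sub>M borel)"
    by (rule measurable_distr_prob_space2[where M=borel]) measurable
  have "emeasure (K a) (A \<times> B)
      = (\<integral>\<^sup>+b. emeasure (distr (P (a, b)) (S \<Otimes>\<^sub>M borel) (\<lambda>z. (b, z))) (A \<times> B) \<partial>Q a)"
    unfolding K_def
    by (rule emeasure_bind_prob_algebra[OF measurable_space[OF Q a] PD]) measurable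
  also have "\<dots> = (\<integral>\<^sup>+b. indicator A b * ennreal (measure (P (a, b)) B) \<partial>Q a)"
  proof (rule nn_integral_cong)
    fix b assume "b \<in> space (Q a)"
    then have b: "b \<in> space S" using sets_eq_imp_space_eq[OF sets_Q[OF a]] by simp
    have Pab: "sets (P (a, b)) = sets borel" "prob_space (P (a, b))"
      using measurable_space[OF P, of "(a, b)"] a b by (auto simp: space_prob_algebra space_pair_measure)
    interpret Pab: prob_space "P (a, b)" by fact
    have "(\<lambda>z. (b, z)) \<in> P (a, b) \<rightarrow>\<^sub>M S \<Otimes>\<^sub>M borel"
      using b by (subst measurable_cong_sets[OF Pab(1) refl]) measurable
    then have "emeasure (distr (P (a, b)) (S \<Otimes>\<^sub>M borel) (\<lambda>z. (b, z))) (A \<times> B)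
      = emeasure (P (a, b)) ((\<lambda>z. (b, z)) -` (A \<times> B) \<inter> space (P (a, b)))"
      by (rule emeasure_distr) measurable
    also have "(\<lambda>z. (b, z)) -` (A \<times> B) \<inter> space (P (a, b)) = (if b \<in> A then B else {})"
      using sets_eq_imp_space_eq[OF Pab(1)] by auto
    finally show "emeasure (distr (P (a, b)) (S \<Otimes>\<^sub>M borel) (\<lambda>z. (b, z))) (A \<times> B)
      = indicator A b * ennreal (measure (P (a, b)) B)"
      by (simp add: Pab.emeasure_eq_measure)
  qed
  finally show ?thesis .
qed

text \<open>
  The Markov property for functions of the whole past and of the next state.
\<close>

lemma nn_integral_next_state:
  assumes G: "G \<in> borel_measurable (generated_by \<Omega> S M {..n} \<Otimes>\<^sub>M S)"
  shows "(\<integral>\<^sup>+\<omega>. G (\<omega>, M (n + 1) \<omega>) \<partial>\<Omega>) = (\<integral>\<^sup>+\<omega>. \<integral>\<^sup>+b. G (\<omega>, b) \<partial>Q (M n \<omega>) \<partial>\<Omega>)"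
proof -
  let ?F = "generated_by \<Omega> S M {..n}"
  note sub = subalgebra_generated_by[OF random_seq_M, of "{..n}"]
  note [measurable] = QP_measurable
  show ?thesis
  proof (rule nn_integral_kernel_generator[where F="?F" and N=S and E="sets ?F" and H="sets S"
        and X="\<lambda>\<omega>. \<omega>" and Y="M (n + 1)" and K="\<lambda>\<omega>. Q (M n \<omega>)" and G=G])
    show "(\<lambda>\<omega>. \<omega>) \<in> \<Omega> \<rightarrow>\<^sub>M ?F" by (rule measurable_from_subalg[OF sub]) simp
    show "(\<lambda>\<omega>. Q (M n \<omega>)) \<in> \<Omega> \<rightarrow>\<^sub>M prob_algebra S"
      using Q by measurable
    show "sets ?F = sigma_sets (space ?F) (sets ?F)" "sets S = sigma_sets (space S) (sets S)"
      by (simp_all add: sets.sigma_sets_eq)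
    show "Int_stable (sets ?F)" "Int_stable (sets S)" by (simp_all add: Int_stable_def)
    show "sets ?F \<subseteq> Pow (space ?F)" "sets S \<subseteq> Pow (space S)"
      by (simp_all add: sets.space_closed)
    fix A B assume A: "A \<in> sets ?F" and B: "B \<in> sets S"
    note [measurable] = B
    have A' [measurable]: "A \<in> sets \<Omega>" using A sub by (auto simp: subalgebra_def)
    have "emeasure \<Omega> {\<omega> \<in> space \<Omega>. \<omega> \<in> A \<and> M (n + 1) \<omega> \<in> B}
        = (\<integral>\<^sup>+\<omega>. indicator {\<omega> \<in> space \<Omega>. \<omega> \<in> A \<and> M (n + 1) \<omega> \<in> B} \<omega> \<partial>\<Omega>)"
      by (rule nn_integral_indicator[symmetric]) measurable
    also have "\<dots> = (\<integral>\<^sup>+\<omega>. ennreal (indicator A \<omega>) * indicator {\<omega> \<in> space \<Omega>. M (n + 1) \<omega> \<in> B} \<omega> \<partial>\<Omega>)"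
      by (intro nn_integral_cong) (auto simp: indicator_def)
    also have "\<dots> = (\<integral>\<^sup>+\<omega>. ennreal (indicator A \<omega>) * ennreal (measure (Q (M n \<omega>)) B) \<partial>\<Omega>)"
      using A B by (intro nn_integral_cond_probability[OF prob_space_axioms sub] markov) auto
    also have "\<dots> = (\<integral>\<^sup>+\<omega>. indicator A \<omega> * emeasure (Q (M n \<omega>)) B \<partial>\<Omega>)"
    proof (rule nn_integral_cong)
      fix \<omega> assume "\<omega> \<in> space \<Omega>"
      then interpret Q: prob_space "Q (M n \<omega>)" by (intro prob_space_Q measurable_space[OF M])
      show "ennreal (indicator A \<omega>) * ennreal (measure (Q (M n \<omega>)) B) = indicator A \<omega> * emeasure (Q (M n \<omega>)) B"
        by (simp add: Q.emeasure_eq_measure ennreal_indicator)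
    qed
    finally show "emeasure \<Omega> {\<omega> \<in> space \<Omega>. \<omega> \<in> A \<and> M (n + 1) \<omega> \<in> B}
        = (\<integral>\<^sup>+\<omega>. indicator A \<omega> * emeasure (Q (M n \<omega>)) B \<partial>\<Omega>)" .
  qed (auto intro: G prob_space_axioms)
qed

lemma nn_integral_increments:
  assumes J: "finite J" and B: "\<And>j. j \<in> J \<Longrightarrow> B j \<in> sets borel"
    and u: "u \<in> borel_measurable (generated_by \<Omega> S M UNIV)" "\<And>\<omega>. 0 \<le> u \<omega>" "\<And>\<omega>. \<omega> \<in> space \<Omega> \<Longrightarrow> u \<omega> \<le> 1"
  shows "(\<integral>\<^sup>+\<omega>. ennreal (u \<omega>) * indicator {\<omega> \<in> space \<Omega>. \<forall>j\<in>J. x j \<omega> \<in> B j} \<omega> \<partial>\<Omega>)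
       = (\<integral>\<^sup>+\<omega>. ennreal (u \<omega>) * ennreal (\<Prod>j\<in>J. measure (P (M (j - 1) \<omega>, M j \<omega>)) (B j)) \<partial>\<Omega>)"
proof (rule nn_integral_cond_probability[OF prob_space_axioms subalgebra_generated_by[OF random_seq_M] u])
  note [measurable] = P B J
  let ?F = "generated_by \<Omega> S M UNIV"
  show "{\<omega> \<in> space \<Omega>. \<forall>j\<in>J. x j \<omega> \<in> B j} \<in> sets \<Omega>"
    using J B by (intro sets.sets_Collect_finite_All) auto
  show "(\<lambda>\<omega>. \<Prod>j\<in>J. measure (P (M (j - 1) \<omega>, M j \<omega>)) (B j)) \<in> borel_measurable \<Omega>"
    using B by (intro borel_measurable_prod measurable_P) auto
  show "0 \<le> (\<Prod>j\<in>J. measure (P (M (j - 1) \<omega>, M j \<omega>)) (B j))" for \<omega>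
    by (intro prod_nonneg) auto
  have "AE \<omega> in \<Omega>. cond_probability \<Omega> ?F {\<omega> \<in> space \<Omega>. \<forall>n\<in>J. x n \<omega> \<in> B n} \<omega>
      = (\<Prod>n\<in>J. cond_probability \<Omega> ?F {\<omega> \<in> space \<Omega>. x n \<omega> \<in> B n} \<omega>)"
    using indep J B unfolding cond_indep_seq_def by blast
  moreover have "AE \<omega> in \<Omega>. \<forall>n\<in>J. cond_probability \<Omega> ?F {\<omega> \<in> space \<Omega>. x n \<omega> \<in> B n} \<omega>
      = measure (P (M (n - 1) \<omega>, M n \<omega>)) (B n)"
    using J B law by (intro AE_finite_allI) auto
  ultimately show "AE \<omega> in \<Omega>. cond_probability \<Omega> ?F {\<omega> \<in> space \<Omega>. \<forall>j\<in>J. x j \<omega> \<in> B j} \<omega>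
      = (\<Prod>j\<in>J. measure (P (M (j - 1) \<omega>, M j \<omega>)) (B j))"
    by eventually_elim simp
qed

text \<open>
  Conditioning on the whole chain turns increments into factors \<open>P (M (j - 1), M j)\<close>. All of
  them except the last depend on the chain up to time \<open>k\<close> only, so the Markov property integrates out the
  state at time \<open>k + 1\<close> and produces \<open>K\<close>; undoing the conditioning restores the earlier increments.
\<close>

lemma history_rectangle:
  assumes J: "finite J" "J \<subseteq> {..k}" and B: "\<And>j. j \<in> J \<Longrightarrow> B j \<in> sets borel"
    and A: "A \<in> sets S" and A': "A' \<in> sets S" and B': "B' \<in> sets borel"
  shows "(\<integral>\<^sup>+\<omega>. indicator {\<omega> \<in> space \<Omega>. M k \<omega> \<in> A \<and> M (k+1) \<omega> \<in> A' \<and> x (k+1) \<omega> \<in> B'} \<omega>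
             * indicator {\<omega> \<in> space \<Omega>. \<forall>j\<in>J. x j \<omega> \<in> B j} \<omega> \<partial>\<Omega>)
       = (\<integral>\<^sup>+\<omega>. indicator A (M k \<omega>) * emeasure (K (M k \<omega>)) (A' \<times> B')
             * indicator {\<omega> \<in> space \<Omega>. \<forall>j\<in>J. x j \<omega> \<in> B j} \<omega> \<partial>\<Omega>)"
proof -
  note [measurable] = P Q A A' B' J(1)
  let ?F = "generated_by \<Omega> S M {..k}" and ?F' = "generated_by \<Omega> S M UNIV"
  have MF [measurable]: "M j \<in> ?F \<rightarrow>\<^sub>M S" if "j \<le> k" for j
    using that by (intro measurable_generated_by random_seq_M) auto
  have MF' [measurable]: "M j \<in> ?F' \<rightarrow>\<^sub>M S" for j
    by (intro measurable_generated_by random_seq_M) auto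
  \<comment> \<open>All increments, the next one included, are treated as one rectangle.\<close>
  define C where "C = B(k+1 := B')"
  have k: "k + 1 \<notin> J" using J(2) by auto
  have C [measurable]: "C j \<in> sets borel" if "j \<in> insert (k+1) J" for j
    using that B B' by (auto simp: C_def)
  have C_J: "(\<forall>j\<in>J. x j \<omega> \<in> C j) \<longleftrightarrow> (\<forall>j\<in>J. x j \<omega> \<in> B j)" for \<omega>
    by (intro ball_cong) (use k in \<open>auto simp: C_def\<close>)
  define p where "p j \<omega> = measure (P (M (j - 1) \<omega>, M j \<omega>)) (C j)" for j \<omega>
  define U where "U \<omega> = indicator A (M k \<omega>) * (\<Prod>j\<in>J. p j \<omega>)" for \<omega>
  have p_nn: "0 \<le> p j \<omega>" for j \<omega> by (simp add: p_def)
  have U_nn: "0 \<le> U \<omega>" for \<omega> unfolding U_def by (intro mult_nonneg_nonneg prod_nonneg) (auto simp: p_nn)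
  have U [measurable]: "U \<in> borel_measurable ?F"
    unfolding U_def p_def
    using J(2) C by (intro borel_measurable_times borel_measurable_prod measurable_P measurable_compose[OF MF]) auto
  have "(\<integral>\<^sup>+\<omega>. indicator {\<omega> \<in> space \<Omega>. M k \<omega> \<in> A \<and> M (k+1) \<omega> \<in> A' \<and> x (k+1) \<omega> \<in> B'} \<omega>
             * indicator {\<omega> \<in> space \<Omega>. \<forall>j\<in>J. x j \<omega> \<in> B j} \<omega> \<partial>\<Omega>)
     = (\<integral>\<^sup>+\<omega>. ennreal (indicator A (M k \<omega>) * indicator A' (M (k+1) \<omega>))
          * indicator {\<omega> \<in> space \<Omega>. \<forall>j\<in>insert (k+1) J. x j \<omega> \<in> C j} \<omega> \<partial>\<Omega>)"
    by (intro nn_integral_cong) (auto simp: indicator_def C_J, simp_all add: C_def)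
  also have "\<dots> = (\<integral>\<^sup>+\<omega>. ennreal (indicator A (M k \<omega>) * indicator A' (M (k+1) \<omega>))
          * ennreal (\<Prod>j\<in>insert (k+1) J. p j \<omega>) \<partial>\<Omega>)"
    unfolding p_def using J(1) C by (intro nn_integral_increments) (auto simp: indicator_def)
  also have "\<dots> = (\<integral>\<^sup>+\<omega>. ennreal (U \<omega>) * (indicator A' (M (k+1) \<omega>) * ennreal (measure (P (M k \<omega>, M (k+1) \<omega>)) B')) \<partial>\<Omega>)"
    using J(1) k U_nn by (intro nn_integral_cong) (auto simp: U_def indicator_def p_def C_def ennreal_mult' mult.commute)
  also have "\<dots> = (\<integral>\<^sup>+\<omega>. \<integral>\<^sup>+b. ennreal (U \<omega>) * (indicator A' b * ennreal (measure (P (M k \<omega>, b)) B')) \<partial>Q (M k \<omega>) \<partial>\<Omega>)"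
    using nn_integral_next_state[where n=k and G="\<lambda>(\<omega>, b). ennreal (U \<omega>) * (indicator A' b * ennreal (measure (P (M k \<omega>, b)) B'))"]
    by simp
  also have "\<dots> = (\<integral>\<^sup>+\<omega>. ennreal (U \<omega>) * emeasure (K (M k \<omega>)) (A' \<times> B') \<partial>\<Omega>)"
  proof (rule nn_integral_cong)
    fix \<omega> assume "\<omega> \<in> space \<Omega>"
    then have s [measurable]: "M k \<omega> \<in> space S" by (rule measurable_space[OF M])
    have m: "(\<lambda>b. measure (P (M k \<omega>, b)) B') \<in> borel_measurable S"
      by (intro measurable_P) (use s B' in auto)
    have "(\<lambda>b. indicator A' b * ennreal (measure (P (M k \<omega>, b)) B')) \<in> borel_measurable S"
      by (intro borel_measurable_times_ennreal measurable_compose[OF m measurable_ennreal]) measurable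
    then show "(\<integral>\<^sup>+b. ennreal (U \<omega>) * (indicator A' b * ennreal (measure (P (M k \<omega>, b)) B')) \<partial>Q (M k \<omega>))
      = ennreal (U \<omega>) * emeasure (K (M k \<omega>)) (A' \<times> B')"
      unfolding emeasure_K_rectangle[OF s A' B'] measurable_cong_sets[OF sets_Q[OF s] refl, symmetric]
      by (rule nn_integral_cmult)
  qed
  also have "\<dots> = (\<integral>\<^sup>+\<omega>. ennreal (indicator A (M k \<omega>) * measure (K (M k \<omega>)) (A' \<times> B')) * ennreal (\<Prod>j\<in>J. p j \<omega>) \<partial>\<Omega>)"
  proof (rule nn_integral_cong)
    fix \<omega> assume "\<omega> \<in> space \<Omega>"
    then interpret K: prob_space "K (M k \<omega>)" by (intro prob_space_K measurable_space[OF M])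
    show "ennreal (U \<omega>) * emeasure (K (M k \<omega>)) (A' \<times> B')
        = ennreal (indicator A (M k \<omega>) * measure (K (M k \<omega>)) (A' \<times> B')) * ennreal (\<Prod>j\<in>J. p j \<omega>)"
      using p_nn by (simp add: U_def K.emeasure_eq_measure ac_simps prod_nonneg flip: ennreal_mult)
  qed
  also have "\<dots> = (\<integral>\<^sup>+\<omega>. ennreal (indicator A (M k \<omega>) * measure (K (M k \<omega>)) (A' \<times> B'))
     * indicator {\<omega> \<in> space \<Omega>. \<forall>j\<in>J. x j \<omega> \<in> C j} \<omega> \<partial>\<Omega>)"
    unfolding p_def
  proof (rule nn_integral_increments[symmetric, where u="\<lambda>\<omega>. indicator A (M k \<omega>) * measure (K (M k \<omega>)) (A' \<times> B')" and B=C])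
    show "(\<lambda>\<omega>. indicator A (M k \<omega>) * measure (K (M k \<omega>)) (A' \<times> B')) \<in> borel_measurable ?F'"
      by (intro borel_measurable_times measurable_compose[OF MF']
          measurable_compose[OF K_kernel measurable_measure_prob_algebra]) measurable
    show "indicator A (M k \<omega>) * measure (K (M k \<omega>)) (A' \<times> B') \<le> 1" if "\<omega> \<in> space \<Omega>" for \<omega>
      using prob_space.prob_le_1[OF prob_space_K[OF measurable_space[OF M that]]]
      by (auto simp: indicator_def)
  qed (use J C in auto)
  also have "\<dots> = (\<integral>\<^sup>+\<omega>. indicator A (M k \<omega>) * emeasure (K (M k \<omega>)) (A' \<times> B')
             * indicator {\<omega> \<in> space \<Omega>. \<forall>j\<in>J. x j \<omega> \<in> B j} \<omega> \<partial>\<Omega>)"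
  proof (rule nn_integral_cong)
    fix \<omega> assume "\<omega> \<in> space \<Omega>"
    then interpret K: prob_space "K (M k \<omega>)" by (intro prob_space_K measurable_space[OF M])
    show "ennreal (indicator A (M k \<omega>) * measure (K (M k \<omega>)) (A' \<times> B')) * indicator {\<omega> \<in> space \<Omega>. \<forall>j\<in>J. x j \<omega> \<in> C j} \<omega>
        = indicator A (M k \<omega>) * emeasure (K (M k \<omega>)) (A' \<times> B')
             * indicator {\<omega> \<in> space \<Omega>. \<forall>j\<in>J. x j \<omega> \<in> B j} \<omega>"
      by (auto simp: K.emeasure_eq_measure C_J indicator_def)
  qed
  finally show ?thesis .
qed

text \<open>
  Both sides define a finite measure on the vectors of past increments. By \<open>history_rectangle\<close> these measures agree on
  boxes, hence on the event that the sum of the increments lies in \<open>B\<close>.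
\<close>

lemma history_sum_rectangle:
  assumes B: "B \<in> sets borel" and A: "A \<in> sets S" and A': "A' \<in> sets S" and B': "B' \<in> sets borel"
  shows "emeasure \<Omega> {\<omega> \<in> space \<Omega>. (M k \<omega> \<in> A \<and> T k \<omega> \<in> B) \<and> (M (int k+1) \<omega> \<in> A' \<and> x (int k+1) \<omega> \<in> B')}
       = (\<integral>\<^sup>+\<omega>. indicator (A \<times> B) (M k \<omega>, T k \<omega>) * emeasure (K (M k \<omega>)) (A' \<times> B') \<partial>\<Omega>)"
proof -
  note [measurable] = A A' B B'
  let ?J = "{1..int k}"
  define f1 :: "'w \<Rightarrow> ennreal" where
    "f1 = indicator {\<omega> \<in> space \<Omega>. M k \<omega> \<in> A \<and> M (int k+1) \<omega> \<in> A' \<and> x (int k+1) \<omega> \<in> B'}"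
  define f2 where "f2 \<omega> = indicator A (M k \<omega>) * emeasure (K (M k \<omega>)) (A' \<times> B')" for \<omega>
  define X where "X \<omega> = (\<lambda>j\<in>?J. x j \<omega>)" for \<omega>
  have f [measurable]: "f1 \<in> borel_measurable \<Omega>" "f2 \<in> borel_measurable \<Omega>"
  proof -
    have "(\<lambda>\<omega>. emeasure (K (M k \<omega>)) (A' \<times> B')) \<in> borel_measurable \<Omega>"
      by (rule measurable_compose[OF M measurable_compose[OF measurable_K measurable_emeasure_subprob_algebra]]) measurable
    then show "f2 \<in> borel_measurable \<Omega>"
      unfolding f2_def by measurable
    show "f1 \<in> borel_measurable \<Omega>"
      unfolding f1_def by measurable
  qed
  have X [measurable]: "X \<in> \<Omega> \<rightarrow>\<^sub>M (\<Pi>\<^sub>M j\<in>?J. borel)"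
    unfolding X_def by measurable
  define D where "D = {v \<in> space (\<Pi>\<^sub>M j\<in>?J. borel). (\<Sum>j\<in>?J. v j) \<in> B}"
  have D [measurable]: "D \<in> sets (\<Pi>\<^sub>M j\<in>?J. (borel :: real measure))"
    unfolding D_def by measurable
  have T_D: "X \<omega> \<in> D \<longleftrightarrow> T k \<omega> \<in> B" for \<omega>
    by (simp add: D_def X_def T_def space_PiM)
  have law_D: "emeasure (distr (density \<Omega> f) (\<Pi>\<^sub>M j\<in>?J. borel) X) D' = (\<integral>\<^sup>+\<omega>. f \<omega> * indicator D' (X \<omega>) \<partial>\<Omega>)"
    if [measurable]: "f \<in> borel_measurable \<Omega>" and D' [measurable]: "D' \<in> sets (\<Pi>\<^sub>M j\<in>?J. borel)" for f D'
  proof -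
    have "emeasure (distr (density \<Omega> f) (\<Pi>\<^sub>M j\<in>?J. borel) X) D' = emeasure (density \<Omega> f) (X -` D' \<inter> space \<Omega>)"
      by (subst emeasure_distr) auto
    also have "\<dots> = (\<integral>\<^sup>+\<omega>. f \<omega> * indicator (X -` D' \<inter> space \<Omega>) \<omega> \<partial>\<Omega>)"
      by (rule emeasure_density) measurable
    also have "\<dots> = (\<integral>\<^sup>+\<omega>. f \<omega> * indicator D' (X \<omega>) \<partial>\<Omega>)"
      by (intro nn_integral_cong) (auto simp: indicator_def)
    finally show ?thesis .
  qed
  have X_box: "indicator (\<Pi>\<^sub>E j\<in>?J. C j) (X \<omega>) = (indicator {\<omega> \<in> space \<Omega>. \<forall>j\<in>?J. x j \<omega> \<in> C j} \<omega> :: ennreal)"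
    if "\<omega> \<in> space \<Omega>" for \<omega> C
    using that by (auto simp: X_def indicator_def PiE_iff extensional_def)
  have "distr (density \<Omega> f1) (\<Pi>\<^sub>M j\<in>?J. borel) X = distr (density \<Omega> f2) (\<Pi>\<^sub>M j\<in>?J. borel) X"
  proof (rule measure_eqI_PiM_finite[where I="?J" and M="\<lambda>_. borel" and A="\<lambda>_. space (\<Pi>\<^sub>M j\<in>?J. (borel :: real measure))"])
    fix C :: "int \<Rightarrow> real set" assume C: "\<And>j. j \<in> ?J \<Longrightarrow> C j \<in> sets borel"
    have C' [measurable]: "(\<Pi>\<^sub>E j\<in>?J. C j) \<in> sets (\<Pi>\<^sub>M j\<in>?J. borel)"
      using C by (intro sets_PiM_I_finite) auto
    have "(\<integral>\<^sup>+\<omega>. f1 \<omega> * indicator (\<Pi>\<^sub>E j\<in>?J. C j) (X \<omega>) \<partial>\<Omega>)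
        = (\<integral>\<^sup>+\<omega>. f1 \<omega> * indicator {\<omega> \<in> space \<Omega>. \<forall>j\<in>?J. x j \<omega> \<in> C j} \<omega> \<partial>\<Omega>)"
      by (intro nn_integral_cong) (simp add: X_box)
    also have "\<dots> = (\<integral>\<^sup>+\<omega>. f2 \<omega> * indicator {\<omega> \<in> space \<Omega>. \<forall>j\<in>?J. x j \<omega> \<in> C j} \<omega> \<partial>\<Omega>)"
      unfolding f1_def f2_def by (rule history_rectangle) (use C A A' B' in auto)
    also have "\<dots> = (\<integral>\<^sup>+\<omega>. f2 \<omega> * indicator (\<Pi>\<^sub>E j\<in>?J. C j) (X \<omega>) \<partial>\<Omega>)"
      by (intro nn_integral_cong) (simp add: X_box)
    finally show "emeasure (distr (density \<Omega> f1) (\<Pi>\<^sub>M j\<in>?J. borel) X) (\<Pi>\<^sub>E j\<in>?J. C j)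
        = emeasure (distr (density \<Omega> f2) (\<Pi>\<^sub>M j\<in>?J. borel) X) (\<Pi>\<^sub>E j\<in>?J. C j)"
      by (simp add: law_D)
  next
    show "range (\<lambda>_. space (\<Pi>\<^sub>M j\<in>?J. (borel :: real measure))) \<subseteq> prod_algebra ?J (\<lambda>_. borel)"
      by (auto simp: space_PiM intro!: prod_algebraI_finite)
    have "(\<integral>\<^sup>+\<omega>. f1 \<omega> * indicator (space (\<Pi>\<^sub>M j\<in>?J. borel)) (X \<omega>) \<partial>\<Omega>) \<le> (\<integral>\<^sup>+\<omega>. 1 \<partial>\<Omega>)"
      by (intro nn_integral_mono) (auto simp: f1_def indicator_def)
    then show "emeasure (distr (density \<Omega> f1) (\<Pi>\<^sub>M j\<in>?J. borel) X) (space (\<Pi>\<^sub>M j\<in>?J. (borel :: real measure))) \<noteq> \<infinity>"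
      by (auto simp: law_D emeasure_space_1 top_unique)
  qed auto
  then have "(\<integral>\<^sup>+\<omega>. f1 \<omega> * indicator D (X \<omega>) \<partial>\<Omega>) = (\<integral>\<^sup>+\<omega>. f2 \<omega> * indicator D (X \<omega>) \<partial>\<Omega>)"
    by (simp flip: law_D)
  moreover have "emeasure \<Omega> {\<omega> \<in> space \<Omega>. (M k \<omega> \<in> A \<and> T k \<omega> \<in> B) \<and> (M (int k+1) \<omega> \<in> A' \<and> x (int k+1) \<omega> \<in> B')}
      = (\<integral>\<^sup>+\<omega>. f1 \<omega> * indicator D (X \<omega>) \<partial>\<Omega>)" (is "emeasure \<Omega> ?H = _")
  proof -
    have "emeasure \<Omega> ?H = (\<integral>\<^sup>+\<omega>. indicator ?H \<omega> \<partial>\<Omega>)"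
      by (rule nn_integral_indicator[symmetric]) measurable
    also have "\<dots> = (\<integral>\<^sup>+\<omega>. f1 \<omega> * indicator D (X \<omega>) \<partial>\<Omega>)"
      by (intro nn_integral_cong) (auto simp: f1_def T_D indicator_def)
    finally show ?thesis .
  qed
  moreover have "(\<integral>\<^sup>+\<omega>. f2 \<omega> * indicator D (X \<omega>) \<partial>\<Omega>)
      = (\<integral>\<^sup>+\<omega>. indicator (A \<times> B) (M k \<omega>, T k \<omega>) * emeasure (K (M k \<omega>)) (A' \<times> B') \<partial>\<Omega>)"
    by (intro nn_integral_cong) (auto simp: f2_def T_D indicator_def)
  ultimately show ?thesis by simp
qed

text \<open>
  The pair of chain and walk is a Markov chain, and \<open>K\<close> governs its steps.
\<close>

lemma nn_integral_step:
  assumes G: "G \<in> borel_measurable ((S \<Otimes>\<^sub>M borel) \<Otimes>\<^sub>M (S \<Otimes>\<^sub>M borel))"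
  shows "(\<integral>\<^sup>+\<omega>. G ((M k \<omega>, T k \<omega>), (M (int k + 1) \<omega>, x (int k + 1) \<omega>)) \<partial>\<Omega>)
       = (\<integral>\<^sup>+\<omega>. \<integral>\<^sup>+y. G ((M k \<omega>, T k \<omega>), y) \<partial>K (M k \<omega>) \<partial>\<Omega>)"
proof -
  let ?R = "{a \<times> b | a b. a \<in> sets S \<and> b \<in> sets (borel :: real measure)}"
  have gen: "sets (S \<Otimes>\<^sub>M borel) = sigma_sets (space (S \<Otimes>\<^sub>M borel)) ?R"
    by (simp add: sets_pair_measure space_pair_measure)
  have sub: "?R \<subseteq> Pow (space (S \<Otimes>\<^sub>M borel))"
    by (auto simp: space_pair_measure dest: sets.sets_into_space)
  have top: "space (S \<Otimes>\<^sub>M borel) \<in> ?R"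
    by (auto simp: space_pair_measure intro!: exI[of _ "space S"] exI[of _ "UNIV :: real set"])
  show ?thesis
  proof (rule nn_integral_kernel_generator[where F="S \<Otimes>\<^sub>M borel" and N="S \<Otimes>\<^sub>M borel"
        and X="\<lambda>\<omega>. (M k \<omega>, T k \<omega>)" and Y="\<lambda>\<omega>. (M (int k + 1) \<omega>, x (int k + 1) \<omega>)"
        and K="\<lambda>\<omega>. K (M k \<omega>)" and G=G,
        OF _ _ _ prob_space_axioms gen Int_stable_pair_measure_generator sub top
          gen Int_stable_pair_measure_generator sub top _ G])
    show "(\<lambda>\<omega>. K (M k \<omega>)) \<in> \<Omega> \<rightarrow>\<^sub>M prob_algebra (S \<Otimes>\<^sub>M borel)"
      using M K_kernel by (rule measurable_compose)
    fix C D assume "C \<in> ?R" "D \<in> ?R"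
    then obtain A B A' B' where CD: "C = A \<times> B" "D = A' \<times> B'"
      and sets: "A \<in> sets S" "B \<in> sets borel" "A' \<in> sets S" "B' \<in> sets borel" by blast
    show "emeasure \<Omega> {\<omega> \<in> space \<Omega>. (M k \<omega>, T k \<omega>) \<in> C \<and> (M (int k + 1) \<omega>, x (int k + 1) \<omega>) \<in> D}
      = (\<integral>\<^sup>+\<omega>. indicator C (M k \<omega>, T k \<omega>) * emeasure (K (M k \<omega>)) D \<partial>\<Omega>)"
      unfolding CD mem_Times_iff fst_conv snd_conv by (rule history_sum_rectangle) (rule sets)+
  qed measurable
qed

section \<open>Translation profiles along the chain\<close>

text \<open>
  The transition operator of \<open>(M\<^sub>k, s + T\<^sub>k)\<close>. For the nonnegative functions that
  it is applied to, the nonnegative integral gives the usual expectation.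
\<close>

definition V :: "('s \<times> real \<Rightarrow> real) \<Rightarrow> 's \<times> real \<Rightarrow> real" where
  "V f p = enn2real (\<integral>\<^sup>+y. ennreal (f (fst y, snd p + snd y)) \<partial>K (fst p))"

text \<open>
  The expected value of \<open>f\<close> along the walk at time \<open>k\<close>, started from a uniform point of \<open>[0, 1]\<close>.
\<close>

definition mass :: "nat \<Rightarrow> ('s \<times> real \<Rightarrow> real) \<Rightarrow> ennreal" where
  "mass k f = (\<integral>\<^sup>+s. (\<integral>\<^sup>+\<omega>. ennreal (f (M (int k) \<omega>, s + T k \<omega>)) \<partial>\<Omega>) * indicator {0..1} s \<partial>lborel)"

text \<open>
  The lower bound on the mass is required at all times because this makes the set invariant under \<open>V\<close>,
  which moves time forward by one. It keeps the minimiser of the norm away from zero.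
\<close>

definition profiles :: "('s \<times> real \<Rightarrow> real) set" where
  "profiles = {f \<in> borel_measurable (S \<Otimes>\<^sub>M borel).
     (\<forall>p \<in> space (S \<Otimes>\<^sub>M borel). 0 \<le> f p \<and> f p \<le> 1) \<and> (\<forall>k. ennreal (1/2) \<le> mass k f)}"

lemma profilesD:
  assumes "f \<in> profiles"
  shows "f \<in> borel_measurable (S \<Otimes>\<^sub>M borel)" "ennreal (1/2) \<le> mass k f"
    and "a \<in> space S \<Longrightarrow> 0 \<le> f (a, s)" "a \<in> space S \<Longrightarrow> f (a, s) \<le> 1"
  using assms by (auto simp: profiles_def space_pair_measure)

lemma V_measurable:
  assumes [measurable]: "f \<in> borel_measurable (S \<Otimes>\<^sub>M borel)"
  shows "V f \<in> borel_measurable (S \<Otimes>\<^sub>M borel)"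
proof -
  have "(\<lambda>p. \<integral>\<^sup>+y. ennreal (f (fst y, snd p + snd y)) \<partial>K (fst p)) \<in> borel_measurable (S \<Otimes>\<^sub>M borel)"
    by (rule nn_integral_measurable_subprob_algebra2[where N="S \<Otimes>\<^sub>M borel"]) measurable
  then show ?thesis unfolding V_def by measurable
qed

lemma
  assumes f: "f \<in> borel_measurable (S \<Otimes>\<^sub>M borel)"
    and bounds: "\<And>a s. a \<in> space S \<Longrightarrow> 0 \<le> f (a, s)" "\<And>a s. a \<in> space S \<Longrightarrow> f (a, s) \<le> 1"
    and a: "a \<in> space S"
  shows V_nonneg: "0 \<le> V f (a, s)" and V_le_1: "V f (a, s) \<le> 1"
    and ennreal_V: "ennreal (V f (a, s)) = (\<integral>\<^sup>+y. ennreal (f (fst y, s + snd y)) \<partial>K a)"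
    and V_jensen: "ennreal ((f (a, s) + V f (a, s))\<^sup>2) \<le> (\<integral>\<^sup>+y. ennreal ((f (a, s) + f (fst y, s + snd y))\<^sup>2) \<partial>K a)"
proof -
  note [measurable] = f
  interpret K: prob_space "K a" by (rule prob_space_K[OF a])
  have space_K: "space (K a) = space S \<times> UNIV"
    using sets_eq_imp_space_eq[OF sets_K[OF a]] by (simp add: space_pair_measure)
  have in_S: "fst y \<in> space S" if "y \<in> space (K a)" for y using that space_K by auto
  have meas [measurable]: "(\<lambda>y. f (fst y, s + snd y)) \<in> borel_measurable (K a)"
    unfolding measurable_cong_sets[OF sets_K[OF a] refl] by measurable
  have int: "integrable (K a) (\<lambda>y. f (fst y, s + snd y))"
    using bounds in_S by (intro K.integrable_const_bound[where B=1]) (auto intro!: AE_I2)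
  have nn: "AE y in K a. 0 \<le> f (fst y, s + snd y)" and le: "AE y in K a. f (fst y, s + snd y) \<le> 1"
    using bounds in_S by (auto intro!: AE_I2)
  have V_int: "V f (a, s) = (\<integral>y. f (fst y, s + snd y) \<partial>K a)"
    unfolding V_def using nn_integral_eq_integral[OF int nn] integral_nonneg_AE[OF nn] by simp
  show "0 \<le> V f (a, s)" unfolding V_int using nn by (rule integral_nonneg_AE)
  show "V f (a, s) \<le> 1" unfolding V_int using K.integral_le_const[OF int le] by simp
  show "ennreal (V f (a, s)) = (\<integral>\<^sup>+y. ennreal (f (fst y, s + snd y)) \<partial>K a)"
    unfolding V_int using nn_integral_eq_integral[OF int nn] by simp
  let ?g = "\<lambda>y. f (a, s) + f (fst y, s + snd y)"
  have g: "integrable (K a) ?g" using int by simp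
  have g2: "integrable (K a) (\<lambda>y. (?g y)\<^sup>2)"
  proof (rule K.integrable_const_bound[where B=4])
    show "AE y in K a. norm ((?g y)\<^sup>2) \<le> 4"
    proof (rule AE_I2)
      fix y assume "y \<in> space (K a)"
      then have "0 \<le> ?g y" "?g y \<le> 2"
        using bounds[OF a, of s] bounds[OF in_S, of y "s + snd y"] by auto
      then have "(?g y)\<^sup>2 \<le> 2\<^sup>2" by (intro power_mono)
      then show "norm ((?g y)\<^sup>2) \<le> 4" by simp
    qed
  qed measurable
  have "(f (a, s) + V f (a, s))\<^sup>2 = (K.expectation ?g)\<^sup>2"
    unfolding V_int using int K.prob_space by simp
  \<comment> \<open>Jensen for the square is nonnegativity of the variance.\<close>
  also have "\<dots> \<le> K.expectation (\<lambda>y. (?g y)\<^sup>2)"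
    using K.variance_positive[of ?g] K.variance_eq[OF g g2] by simp
  finally have "ennreal ((f (a, s) + V f (a, s))\<^sup>2) \<le> ennreal (K.expectation (\<lambda>y. (?g y)\<^sup>2))"
    by (rule ennreal_leI)
  also have "\<dots> = (\<integral>\<^sup>+y. ennreal ((?g y)\<^sup>2) \<partial>K a)"
    using nn_integral_eq_integral[OF g2] by simp
  finally show "ennreal ((f (a, s) + V f (a, s))\<^sup>2) \<le> (\<integral>\<^sup>+y. ennreal ((?g y)\<^sup>2) \<partial>K a)" .
qed

lemma mass_V:
  assumes f: "f \<in> profiles"
  shows "mass k (V f) = mass (Suc k) f"
proof -
  note [measurable] = profilesD(1)[OF f] V_measurable[OF profilesD(1)[OF f]]
  have "(\<integral>\<^sup>+\<omega>. ennreal (V f (M (int k) \<omega>, s + T k \<omega>)) \<partial>\<Omega>)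
      = (\<integral>\<^sup>+\<omega>. ennreal (f (M (int (Suc k)) \<omega>, s + T (Suc k) \<omega>)) \<partial>\<Omega>)" for s
  proof -
    let ?G = "\<lambda>q. ennreal (f (fst (snd q), s + snd (fst q) + snd (snd q)))"
    have "(\<integral>\<^sup>+\<omega>. ennreal (V f (M (int k) \<omega>, s + T k \<omega>)) \<partial>\<Omega>)
        = (\<integral>\<^sup>+\<omega>. \<integral>\<^sup>+y. ?G ((M (int k) \<omega>, T k \<omega>), y) \<partial>K (M (int k) \<omega>) \<partial>\<Omega>)"
      using profilesD[OF f] measurable_space[OF M]
      by (intro nn_integral_cong) (simp add: ennreal_V)
    also have "\<dots> = (\<integral>\<^sup>+\<omega>. ?G ((M (int k) \<omega>, T k \<omega>), (M (int k + 1) \<omega>, x (int k + 1) \<omega>)) \<partial>\<Omega>)"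
      by (rule nn_integral_step[symmetric]) measurable
    also have "\<dots> = (\<integral>\<^sup>+\<omega>. ennreal (f (M (int (Suc k)) \<omega>, s + T (Suc k) \<omega>)) \<partial>\<Omega>)"
      by (simp add: T_Suc add.assoc add.commute[of 1])
    finally show ?thesis .
  qed
  then show ?thesis by (simp add: mass_def)
qed

lemma V_profiles:
  assumes f: "f \<in> profiles"
  shows "V f \<in> profiles"
proof -
  have "0 \<le> V f p \<and> V f p \<le> 1" if "p \<in> space (S \<Otimes>\<^sub>M borel)" for p
    using that V_nonneg[OF profilesD(1,3,4)[OF f]] V_le_1[OF profilesD(1,3,4)[OF f]]
    by (cases p) (simp add: space_pair_measure)
  moreover have "ennreal (1/2) \<le> mass k (V f)" for k
    unfolding mass_V[OF f] by (rule profilesD(2)[OF f])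
  ultimately show ?thesis
    using V_measurable[OF profilesD(1)[OF f]] unfolding profiles_def by blast
qed

lemma mid_profiles:
  assumes f: "f \<in> profiles" and g: "g \<in> profiles"
  shows "(\<lambda>p. (f p + g p) / 2) \<in> profiles"
proof -
  note [measurable] = profilesD(1)[OF f] profilesD(1)[OF g]
  define \<phi> where "\<phi> k f s = (\<integral>\<^sup>+\<omega>. ennreal (f (M (int k) \<omega>, s + T k \<omega>)) \<partial>\<Omega>)"
    for k :: nat and f :: "'s \<times> real \<Rightarrow> real" and s :: real
  have [measurable]: "\<phi> k f \<in> borel_measurable borel" "\<phi> k g \<in> borel_measurable borel" for k
    unfolding \<phi>_def by measurable
  have mass_\<phi>: "mass k f = (\<integral>\<^sup>+s. \<phi> k f s * indicator {0..1} s \<partial>lborel)" for k f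
    by (simp add: mass_def \<phi>_def)
  have mid: "\<phi> k (\<lambda>p. (f p + g p) / 2) s = ennreal (1/2) * (\<phi> k f s + \<phi> k g s)" for k s
  proof -
    have "\<phi> k (\<lambda>p. (f p + g p) / 2) s
      = (\<integral>\<^sup>+\<omega>. ennreal (1/2) * (ennreal (f (M (int k) \<omega>, s + T k \<omega>)) + ennreal (g (M (int k) \<omega>, s + T k \<omega>))) \<partial>\<Omega>)"
      unfolding \<phi>_def
    proof (rule nn_integral_cong)
      fix \<omega> assume "\<omega> \<in> space \<Omega>"
      then have s: "M (int k) \<omega> \<in> space S" by (rule measurable_space[OF M])
      show "ennreal ((f (M (int k) \<omega>, s + T k \<omega>) + g (M (int k) \<omega>, s + T k \<omega>)) / 2)
        = ennreal (1/2) * (ennreal (f (M (int k) \<omega>, s + T k \<omega>)) + ennreal (g (M (int k) \<omega>, s + T k \<omega>)))"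
        using profilesD(3)[OF f s, of "s + T k \<omega>"] profilesD(3)[OF g s, of "s + T k \<omega>"]
        by (subst ennreal_plus[symmetric], simp, simp, subst ennreal_mult[symmetric]) simp_all
    qed
    also have "\<dots> = ennreal (1/2) * (\<phi> k f s + \<phi> k g s)"
      unfolding \<phi>_def by (subst nn_integral_cmult, measurable) (subst nn_integral_add, auto)
    finally show ?thesis .
  qed
  have "ennreal (1/2) \<le> mass k (\<lambda>p. (f p + g p) / 2)" for k
  proof -
    have "ennreal (1/2 * (1/2 + 1/2)) = ennreal (1/2) * ennreal (1/2 + 1/2)"
      by (rule ennreal_mult) simp_all
    moreover have "ennreal (1/2 + 1/2) = ennreal (1/2) + ennreal (1/2)"
      by (rule ennreal_plus) simp_all
    moreover have "1/2 * (1/2 + 1/2) = (1/2 :: real)" by simp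
    ultimately have "ennreal (1/2) = ennreal (1/2) * (ennreal (1/2) + ennreal (1/2))"
      by (simp only:)
    also have "\<dots> \<le> ennreal (1/2) * (mass k f + mass k g)"
      using profilesD(2)[OF f, of k] profilesD(2)[OF g, of k] by (intro mult_left_mono add_mono) auto
    also have "\<dots> = (\<integral>\<^sup>+s. ennreal (1/2) * (\<phi> k f s * indicator {0..1} s + \<phi> k g s * indicator {0..1} s) \<partial>lborel)"
      unfolding mass_\<phi> by (subst nn_integral_cmult, measurable) (subst nn_integral_add, auto)
    also have "\<dots> = mass k (\<lambda>p. (f p + g p) / 2)"
      unfolding mass_\<phi> mid by (intro nn_integral_cong) (simp add: distrib_right mult.assoc)
    finally show ?thesis .
  qed
  moreover have "0 \<le> (f p + g p) / 2 \<and> (f p + g p) / 2 \<le> 1" if "p \<in> space (S \<Otimes>\<^sub>M borel)" for p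
  proof -
    have "0 \<le> f p \<and> f p \<le> 1 \<and> 0 \<le> g p \<and> g p \<le> 1" using f g that by (auto simp: profiles_def)
    then show ?thesis by auto
  qed
  ultimately show ?thesis by (simp add: profiles_def)
qed

text \<open>
  This is where tightness enters: for \<open>s\<close> in \<open>[0, 1]\<close>, the point \<open>s + T k\<close> lies in the window whenever
  \<open>\<bar>T k\<bar> \<le> R\<close>.
\<close>

lemma window_profile:
  assumes R: "0 \<le> R" "\<And>k. prob {\<omega> \<in> space \<Omega>. R < \<bar>T k \<omega>\<bar>} \<le> 1/2"
  shows "(\<lambda>p. indicator {-R-1..R+1} (snd p)) \<in> profiles"
proof -
  have "ennreal (1/2) \<le> mass k (\<lambda>p. indicator {-R-1..R+1} (snd p))" for k
  proof -
    have "ennreal (1/2) \<le> (\<integral>\<^sup>+\<omega>. ennreal (indicator {-R-1..R+1} (s + T k \<omega>)) \<partial>\<Omega>)" if s: "s \<in> {0..1}" for s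
    proof -
      have "prob (space \<Omega> - {\<omega> \<in> space \<Omega>. R < \<bar>T k \<omega>\<bar>}) = 1 - prob {\<omega> \<in> space \<Omega>. R < \<bar>T k \<omega>\<bar>}"
        by (rule prob_compl) measurable
      then have "1/2 \<le> prob (space \<Omega> - {\<omega> \<in> space \<Omega>. R < \<bar>T k \<omega>\<bar>})" using R(2)[of k] by simp
      then have "ennreal (1/2) \<le> emeasure \<Omega> (space \<Omega> - {\<omega> \<in> space \<Omega>. R < \<bar>T k \<omega>\<bar>})"
        unfolding emeasure_eq_measure by (rule ennreal_leI)
      also have "\<dots> = (\<integral>\<^sup>+\<omega>. indicator (space \<Omega> - {\<omega> \<in> space \<Omega>. R < \<bar>T k \<omega>\<bar>}) \<omega> \<partial>\<Omega>)"
        by (rule nn_integral_indicator[symmetric]) measurable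
      also have "\<dots> \<le> (\<integral>\<^sup>+\<omega>. ennreal (indicator {-R-1..R+1} (s + T k \<omega>)) \<partial>\<Omega>)"
        using s by (intro nn_integral_mono) (auto simp: indicator_def)
      finally show ?thesis .
    qed
    then have "(\<integral>\<^sup>+s. ennreal (1/2) * indicator {0..1::real} s \<partial>lborel) \<le> mass k (\<lambda>p. indicator {-R-1..R+1} (snd p))"
      unfolding mass_def by (intro nn_integral_mono) (auto simp: indicator_def)
    moreover have "(\<integral>\<^sup>+s. ennreal (1/2) * indicator {0..1::real} s \<partial>lborel) = ennreal (1/2)"
      by (simp add: nn_integral_cmult_indicator)
    ultimately show ?thesis by simp
  qed
  then show ?thesis by (simp add: profiles_def indicator_def)
qed

text \<open>
  The element of minimal norm for the one-step maps \<open>(\<omega>, s) \<mapsto> (M\<^sub>0, s)\<close> and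
  \<open>(\<omega>, s) \<mapsto> (M\<^sub>1, s + x\<^sub>1)\<close>. They have the same image measure because Lebesgue measure is
  translation invariant, and \<open>M\<^sub>0\<close>, \<open>M\<^sub>1\<close> have the same law. The mass bound passes to the limit by
  dominated convergence, since profiles are bounded by 1 and the mass only looks at \<open>0 \<le> s \<le> 1\<close>.
\<close>

lemma exists_invariant_profile:
  assumes law_M: "distr \<Omega> S (M 1) = distr \<Omega> S (M 0)"
    and R: "0 \<le> R" "\<And>k. prob {\<omega> \<in> space \<Omega>. R < \<bar>T k \<omega>\<bar>} \<le> 1/2"
  obtains h where "h \<in> borel_measurable (S \<Otimes>\<^sub>M borel)"
    "AE \<omega> in \<Omega>. AE s in lborel. h (M 0 \<omega>, s) = h (M 1 \<omega>, s + x 1 \<omega>)"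
    "AE \<omega> in \<Omega>. (\<integral>\<^sup>+s. ennreal ((h (M 0 \<omega>, s))\<^sup>2) \<partial>lborel) < \<infinity>"
    "\<not> (AE \<omega> in \<Omega>. (\<integral>\<^sup>+s. ennreal ((h (M 0 \<omega>, s))\<^sup>2) \<partial>lborel) = 0)"
proof -
  define \<Lambda> where "\<Lambda> = \<Omega> \<Otimes>\<^sub>M (lborel :: real measure)"
  interpret \<Lambda>: pair_sigma_finite \<Omega> "lborel :: real measure" ..
  define a0 where "a0 q = (M 0 (fst q), snd q)" for q :: "'w \<times> real"
  define a1 where "a1 q = (M 1 (fst q), snd q + x 1 (fst q))" for q :: "'w \<times> real"
  have a [measurable]: "a0 \<in> \<Lambda> \<rightarrow>\<^sub>M S \<Otimes>\<^sub>M borel" "a1 \<in> \<Lambda> \<rightarrow>\<^sub>M S \<Otimes>\<^sub>M borel"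
    unfolding a0_def a1_def \<Lambda>_def by measurable
  have fst_in: "fst q \<in> space \<Omega>" if "q \<in> space \<Lambda>" for q
    using that by (auto simp: \<Lambda>_def space_pair_measure)
  have integral_\<Lambda>: "(\<integral>\<^sup>+q. g q \<partial>\<Lambda>) = (\<integral>\<^sup>+\<omega>. \<integral>\<^sup>+s. g (\<omega>, s) \<partial>lborel \<partial>\<Omega>)"
    "(\<integral>\<^sup>+q. g q \<partial>\<Lambda>) = (\<integral>\<^sup>+s. \<integral>\<^sup>+\<omega>. g (\<omega>, s) \<partial>\<Omega> \<partial>lborel)"
    if "g \<in> borel_measurable \<Lambda>" for g :: "_ \<Rightarrow> ennreal"
    using that unfolding \<Lambda>_def
    by (simp_all only: lborel.nn_integral_fst \<Lambda>.nn_integral_snd)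
  have distr_a: "distr \<Lambda> (S \<Otimes>\<^sub>M borel) a1 = distr \<Lambda> (S \<Otimes>\<^sub>M borel) a0"
  proof (rule measure_eqI)
    fix A assume "A \<in> sets (distr \<Lambda> (S \<Otimes>\<^sub>M borel) a1)"
    then have A [measurable]: "A \<in> sets (S \<Otimes>\<^sub>M borel)" by simp
    define \<phi> where "\<phi> a = (\<integral>\<^sup>+s. indicator A (a, s) \<partial>lborel)" for a
    have \<phi> [measurable]: "\<phi> \<in> borel_measurable S" unfolding \<phi>_def by measurable
    have em: "emeasure (distr \<Lambda> (S \<Otimes>\<^sub>M borel) f) A = (\<integral>\<^sup>+q. indicator A (f q) \<partial>\<Lambda>)"
      if [measurable]: "f \<in> \<Lambda> \<rightarrow>\<^sub>M S \<Otimes>\<^sub>M borel" for f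
      using nn_integral_distr[OF that, of "indicator A"] nn_integral_indicator[of A "distr \<Lambda> (S \<Otimes>\<^sub>M borel) f"]
      by simp
    have "emeasure (distr \<Lambda> (S \<Otimes>\<^sub>M borel) a1) A
        = (\<integral>\<^sup>+\<omega>. \<integral>\<^sup>+s. indicator A (M 1 \<omega>, s + x 1 \<omega>) \<partial>lborel \<partial>\<Omega>)"
      by (simp add: em integral_\<Lambda>(1)) (simp add: a1_def)
    also have "\<dots> = (\<integral>\<^sup>+\<omega>. \<phi> (M 1 \<omega>) \<partial>\<Omega>)"
    proof (rule nn_integral_cong)
      fix \<omega> assume "\<omega> \<in> space \<Omega>"
      then have [measurable]: "M 1 \<omega> \<in> space S" by (rule measurable_space[OF M])
      have "(\<lambda>s. indicator A (M 1 \<omega>, s) :: ennreal) \<in> borel_measurable borel" by measurable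
      from nn_integral_real_affine[OF this, of 1 "x 1 \<omega>"]
      show "(\<integral>\<^sup>+s. indicator A (M 1 \<omega>, s + x 1 \<omega>) \<partial>lborel) = \<phi> (M 1 \<omega>)"
        by (simp add: \<phi>_def add.commute)
    qed
    also have "\<dots> = (\<integral>\<^sup>+\<omega>. \<phi> (M 0 \<omega>) \<partial>\<Omega>)"
      using nn_integral_distr[OF M[of 1], of \<phi>] nn_integral_distr[OF M[of 0], of \<phi>] law_M by simp
    also have "\<dots> = emeasure (distr \<Lambda> (S \<Otimes>\<^sub>M borel) a0) A"
      by (simp add: em integral_\<Lambda>(1)) (simp add: a0_def \<phi>_def)
    finally show "emeasure (distr \<Lambda> (S \<Otimes>\<^sub>M borel) a1) A = emeasure (distr \<Lambda> (S \<Otimes>\<^sub>M borel) a0) A" .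
  qed simp
  have jensen: "(\<integral>\<^sup>+q. ennreal ((f (a0 q) + V f (a0 q))\<^sup>2) \<partial>\<Lambda>) \<le> (\<integral>\<^sup>+q. ennreal ((f (a0 q) + f (a1 q))\<^sup>2) \<partial>\<Lambda>)"
    if f: "f \<in> profiles" for f
  proof -
    note [measurable] = profilesD(1)[OF f] V_measurable[OF profilesD(1)[OF f]]
    have "(\<integral>\<^sup>+q. ennreal ((f (a0 q) + V f (a0 q))\<^sup>2) \<partial>\<Lambda>)
        = (\<integral>\<^sup>+s. \<integral>\<^sup>+\<omega>. ennreal ((f (M 0 \<omega>, s) + V f (M 0 \<omega>, s))\<^sup>2) \<partial>\<Omega> \<partial>lborel)"
      by (subst integral_\<Lambda>(2), measurable) (simp add: a0_def)
    also have "\<dots> \<le> (\<integral>\<^sup>+s. \<integral>\<^sup>+\<omega>. ennreal ((f (M 0 \<omega>, s) + f (M 1 \<omega>, s + x 1 \<omega>))\<^sup>2) \<partial>\<Omega> \<partial>lborel)"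
    proof (rule nn_integral_mono)
      fix s :: real
      let ?G = "\<lambda>q :: ('s \<times> real) \<times> ('s \<times> real). ennreal ((f (fst (fst q), s) + f (fst (snd q), s + snd (snd q)))\<^sup>2)"
      have "(\<integral>\<^sup>+\<omega>. ennreal ((f (M 0 \<omega>, s) + V f (M 0 \<omega>, s))\<^sup>2) \<partial>\<Omega>)
         \<le> (\<integral>\<^sup>+\<omega>. \<integral>\<^sup>+y. ?G ((M (int 0) \<omega>, T 0 \<omega>), y) \<partial>K (M (int 0) \<omega>) \<partial>\<Omega>)"
      proof (rule nn_integral_mono)
        fix \<omega> assume "\<omega> \<in> space \<Omega>"
        then have s: "M 0 \<omega> \<in> space S" by (rule measurable_space[OF M])
        show "ennreal ((f (M 0 \<omega>, s) + V f (M 0 \<omega>, s))\<^sup>2) \<le> (\<integral>\<^sup>+y. ?G ((M (int 0) \<omega>, T 0 \<omega>), y) \<partial>K (M (int 0) \<omega>))"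
          using V_jensen[OF profilesD(1,3,4)[OF f] s, of s] by simp
      qed
      also have "\<dots> = (\<integral>\<^sup>+\<omega>. ?G ((M (int 0) \<omega>, T 0 \<omega>), (M (int 0 + 1) \<omega>, x (int 0 + 1) \<omega>)) \<partial>\<Omega>)"
        by (rule nn_integral_step[symmetric]) measurable
      finally show "(\<integral>\<^sup>+\<omega>. ennreal ((f (M 0 \<omega>, s) + V f (M 0 \<omega>, s))\<^sup>2) \<partial>\<Omega>)
         \<le> (\<integral>\<^sup>+\<omega>. ennreal ((f (M 0 \<omega>, s) + f (M 1 \<omega>, s + x 1 \<omega>))\<^sup>2) \<partial>\<Omega>)" by simp
    qed
    also have "\<dots> = (\<integral>\<^sup>+q. ennreal ((f (a0 q) + f (a1 q))\<^sup>2) \<partial>\<Lambda>)"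
      by (subst integral_\<Lambda>(2), measurable) (simp add: a0_def a1_def)
    finally show ?thesis .
  qed
  define \<psi> :: "'s \<times> real \<Rightarrow> real" where "\<psi> p = indicator {-R-1..R+1} (snd p)" for p
  have \<psi>: "\<psi> \<in> profiles" using window_profile[OF R] unfolding \<psi>_def[abs_def] .
  have \<psi>_fin: "(\<integral>\<^sup>+q. ennreal ((\<psi> (a0 q))\<^sup>2) \<partial>\<Lambda>) < \<infinity>"
  proof -
    note [measurable] = profilesD(1)[OF \<psi>]
    have "(\<integral>\<^sup>+q. ennreal ((\<psi> (a0 q))\<^sup>2) \<partial>\<Lambda>) = (\<integral>\<^sup>+\<omega>. \<integral>\<^sup>+s. indicator {-R-1..R+1} s \<partial>lborel \<partial>\<Omega>)"
      by (subst integral_\<Lambda>(1), measurable) (intro nn_integral_cong, simp add: \<psi>_def a0_def indicator_def)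
    also have "\<dots> < \<infinity>" using R(1) by (simp add: emeasure_space_1)
    finally show ?thesis .
  qed
  obtain f h where f_in: "\<forall>n::nat. f n \<in> profiles" and h [measurable]: "h \<in> borel_measurable (S \<Otimes>\<^sub>M borel)"
    and lim: "AE q in \<Lambda>. (\<lambda>n. f n (a0 q)) \<longlonglongrightarrow> h (a0 q)"
    and inv: "AE q in \<Lambda>. h (a0 q) = h (a1 q)" and fin: "(\<integral>\<^sup>+q. ennreal ((h (a0 q))\<^sup>2) \<partial>\<Lambda>) < \<infinity>"
    by (rule minimal_norm_invariant[of a0 \<Lambda> _ a1 profiles V \<psi>,
          OF a distr_a profilesD(1) mid_profiles V_profiles jensen \<psi> \<psi>_fin])
  have f: "f n \<in> profiles" for n using f_in by blast
  note [measurable] = profilesD(1)[OF f]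

  show thesis
  proof
    show "h \<in> borel_measurable (S \<Otimes>\<^sub>M borel)" by fact
    show "AE \<omega> in \<Omega>. AE s in lborel. h (M 0 \<omega>, s) = h (M 1 \<omega>, s + x 1 \<omega>)"
      using \<Lambda>.AE_pair[OF inv[unfolded \<Lambda>_def]] by (simp add: a0_def a1_def)
    have norm: "(\<integral>\<^sup>+q. ennreal ((h (a0 q))\<^sup>2) \<partial>\<Lambda>) = (\<integral>\<^sup>+\<omega>. \<integral>\<^sup>+s. ennreal ((h (M 0 \<omega>, s))\<^sup>2) \<partial>lborel \<partial>\<Omega>)"
      by (subst integral_\<Lambda>(1), measurable) (simp add: a0_def)
    have "AE \<omega> in \<Omega>. (\<integral>\<^sup>+s. ennreal ((h (M 0 \<omega>, s))\<^sup>2) \<partial>lborel) \<noteq> \<infinity>"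
      using fin unfolding norm by (intro nn_integral_PInf_AE) auto
    then show "AE \<omega> in \<Omega>. (\<integral>\<^sup>+s. ennreal ((h (M 0 \<omega>, s))\<^sup>2) \<partial>lborel) < \<infinity>"
      by (simp add: less_top)
    show "\<not> (AE \<omega> in \<Omega>. (\<integral>\<^sup>+s. ennreal ((h (M 0 \<omega>, s))\<^sup>2) \<partial>lborel) = 0)"
    proof
      assume "AE \<omega> in \<Omega>. (\<integral>\<^sup>+s. ennreal ((h (M 0 \<omega>, s))\<^sup>2) \<partial>lborel) = 0"
      then have "(\<integral>\<^sup>+q. ennreal ((h (a0 q))\<^sup>2) \<partial>\<Lambda>) = 0"
        unfolding norm by (subst nn_integral_0_iff_AE) auto
      then have h0: "AE q in \<Lambda>. h (a0 q) = 0"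
        by (subst (asm) nn_integral_0_iff_AE) (auto elim!: eventually_mono)
      define w :: "'w \<times> real \<Rightarrow> ennreal" where "w q = indicator {0..1} (snd q)" for q
      have [measurable]: "w \<in> borel_measurable \<Lambda>" unfolding w_def \<Lambda>_def by measurable
      have "(\<lambda>n. \<integral>\<^sup>+q. ennreal (f n (a0 q)) * w q \<partial>\<Lambda>) \<longlonglongrightarrow> (\<integral>\<^sup>+q. 0 \<partial>\<Lambda>)"
      proof (rule nn_integral_dominated_convergence[where w=w])
        show "AE q in \<Lambda>. ennreal (f n (a0 q)) * w q \<le> w q" for n
        proof (rule AE_I2)
          fix q assume "q \<in> space \<Lambda>"
          then have "f n (a0 q) \<le> 1"
            using profilesD(4)[OF f measurable_space[OF M fst_in]] by (simp add: a0_def)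
          then have "ennreal (f n (a0 q)) * w q \<le> 1 * w q"
            by (intro mult_right_mono) auto
          then show "ennreal (f n (a0 q)) * w q \<le> w q" by simp
        qed
        have "(\<integral>\<^sup>+q. w q \<partial>\<Lambda>) = (\<integral>\<^sup>+\<omega>. \<integral>\<^sup>+s. indicator {0..1::real} s \<partial>lborel \<partial>\<Omega>)"
          by (subst integral_\<Lambda>(1), measurable) (simp add: w_def)
        also have "\<dots> < \<infinity>" by (simp add: emeasure_space_1)
        finally show "(\<integral>\<^sup>+q. w q \<partial>\<Lambda>) < \<infinity>" .
        show "AE q in \<Lambda>. (\<lambda>n. ennreal (f n (a0 q)) * w q) \<longlonglongrightarrow> 0"
          using lim h0
        proof eventually_elim
          case (elim q)
          then have "(\<lambda>n. ennreal (f n (a0 q))) \<longlonglongrightarrow> ennreal 0" by (intro tendsto_ennrealI) simp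
          then have "(\<lambda>n. ennreal (f n (a0 q)) * w q) \<longlonglongrightarrow> ennreal 0 * w q"
            by (intro tendsto_mult_ennreal tendsto_const) (auto simp: w_def indicator_def)
          then show ?case by simp
        qed
      qed measurable
      moreover have "(\<integral>\<^sup>+q. ennreal (f n (a0 q)) * w q \<partial>\<Lambda>) = mass 0 (f n)" for n
        by (subst integral_\<Lambda>(2), measurable) (simp add: mass_def w_def a0_def nn_integral_multc)
      ultimately have "(\<lambda>n. mass 0 (f n)) \<longlonglongrightarrow> 0" by simp
      moreover have "\<forall>\<^sub>F n in sequentially. ennreal (1/2) \<le> mass 0 (f n)"
        using profilesD(2)[OF f] by simp
      ultimately have "ennreal (1/2) \<le> 0"
        by (rule tendsto_lowerbound) simp
      then show False by simp
    qed
  qed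
qed

section \<open>Increments of a tight walk\<close>

text \<open>
  The measures \<open>h(a, s)\<^sup>2 ds\<close> at \<open>a = M\<^sub>0\<close> and \<open>a = M\<^sub>1\<close> are translates of each other by
  \<open>x\<^sub>1\<close>, so their medians differ by \<open>x\<^sub>1\<close>. Their total masses coincide; hence the set of states
  with positive finite mass is invariant along the chain and, by ergodicity, contains \<open>M\<^sub>0\<close> almost surely.
\<close>

theorem increment_is_coboundary:
  assumes law_M: "distr \<Omega> S (M 1) = distr \<Omega> S (M 0)"
    and ergodic: "\<And>A. A \<in> sets S \<Longrightarrow> (AE \<omega> in \<Omega>. M 0 \<omega> \<in> A \<longleftrightarrow> M 1 \<omega> \<in> A) \<Longrightarrow>
      (AE \<omega> in \<Omega>. M 0 \<omega> \<in> A) \<or> (AE \<omega> in \<Omega>. M 0 \<omega> \<notin> A)"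
    and R: "0 \<le> R" "\<And>k. prob {\<omega> \<in> space \<Omega>. R < \<bar>T k \<omega>\<bar>} \<le> 1/2"
  shows "\<exists>\<xi> \<in> borel_measurable S. AE \<omega> in \<Omega>. x 1 \<omega> = \<xi> (M 1 \<omega>) - \<xi> (M 0 \<omega>)"
proof -
  obtain h where h [measurable]: "h \<in> borel_measurable (S \<Otimes>\<^sub>M borel)"
    and inv: "AE \<omega> in \<Omega>. AE s in lborel. h (M 0 \<omega>, s) = h (M 1 \<omega>, s + x 1 \<omega>)"
    and fin: "AE \<omega> in \<Omega>. (\<integral>\<^sup>+s. ennreal ((h (M 0 \<omega>, s))\<^sup>2) \<partial>lborel) < \<infinity>"
    and nonzero: "\<not> (AE \<omega> in \<Omega>. (\<integral>\<^sup>+s. ennreal ((h (M 0 \<omega>, s))\<^sup>2) \<partial>lborel) = 0)"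
    by (rule exists_invariant_profile[OF law_M R])
  define \<mu> where "\<mu> a = density lborel (\<lambda>s. ennreal ((h (a, s))\<^sup>2))" for a
  define N where "N a = (\<integral>\<^sup>+s. ennreal ((h (a, s))\<^sup>2) \<partial>lborel)" for a
  define I where "I a u = (\<integral>\<^sup>+s. ennreal ((h (a, s))\<^sup>2) * indicator {..u} s \<partial>lborel)" for a u
  have N [measurable]: "N \<in> borel_measurable S" unfolding N_def by measurable
  have I: "(\<lambda>a. I a u) \<in> borel_measurable S" for u unfolding I_def by measurable
  have \<mu>_space: "space (\<mu> a) = UNIV" for a by (simp add: \<mu>_def)
  have h_a: "(\<lambda>s. ennreal ((h (a, s))\<^sup>2)) \<in> borel_measurable borel" if "a \<in> space S" for a
    using that by measurable
  have \<mu>_I: "measure (\<mu> a) {..u} = enn2real (I a u)" and \<mu>_N: "measure (\<mu> a) (space (\<mu> a)) = enn2real (N a)"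
    if "a \<in> space S" for a u
    using h_a[OF that] by (simp_all add: measure_def \<mu>_def emeasure_density I_def N_def)
  define Good where "Good = {a \<in> space S. 0 < N a \<and> N a < \<infinity>}"
  have [measurable]: "Good \<in> sets S" unfolding Good_def by measurable
  have Good_space: "a \<in> space S" if "a \<in> Good" for a using that by (simp add: Good_def)
  have \<mu>: "finite_borel_measure (\<mu> a)" and pos: "0 < measure (\<mu> a) (space (\<mu> a))" if "a \<in> Good" for a
  proof -
    have a: "a \<in> space S" "0 < N a" "N a < \<infinity>" using that by (auto simp: Good_def)
    show "finite_borel_measure (\<mu> a)"
      unfolding finite_borel_measure_def finite_borel_measure_axioms_def
    proof (intro conjI finite_measureI)
      show "emeasure (\<mu> a) (space (\<mu> a)) \<noteq> \<infinity>"
        using a h_a[OF a(1)] by (simp add: \<mu>_def emeasure_density N_def less_top)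
    qed (simp add: \<mu>_def)
    show "0 < measure (\<mu> a) (space (\<mu> a))"
      unfolding \<mu>_N[OF a(1)] using a by (simp add: enn2real_positive_iff)
  qed
  have shift: "AE \<omega> in \<Omega>. N (M 1 \<omega>) = N (M 0 \<omega>) \<and> (\<forall>u. I (M 1 \<omega>) (u + x 1 \<omega>) = I (M 0 \<omega>) u)"
    using inv AE_space
  proof eventually_elim
    case (elim \<omega>)
    let ?a = "M 0 \<omega>" and ?b = "M 1 \<omega>" and ?c = "x 1 \<omega>"
    have b: "?b \<in> space S" using elim(2) by (rule measurable_space[OF M])
    note [measurable] = h_a[OF b]
    have "N ?b = (\<integral>\<^sup>+s. ennreal ((h (?b, s + ?c))\<^sup>2) \<partial>lborel)"
      unfolding N_def by (subst nn_integral_real_affine[OF h_a[OF b], of 1 ?c]) (simp_all add: add.commute)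
    also have "\<dots> = N ?a"
      unfolding N_def by (rule nn_integral_cong_AE) (use elim(1) in eventually_elim, simp)
    finally have 1: "N ?b = N ?a" .
    have 2: "I ?b (u + ?c) = I ?a u" for u
    proof -
      have "(\<lambda>s. ennreal ((h (?b, s))\<^sup>2) * indicator {..u + ?c} s) \<in> borel_measurable borel"
        by measurable
      then have "I ?b (u + ?c) = (\<integral>\<^sup>+s. ennreal ((h (?b, s + ?c))\<^sup>2) * indicator {..u + ?c} (s + ?c) \<partial>lborel)"
        unfolding I_def by (subst nn_integral_real_affine[of _ 1 ?c]) (simp_all add: add.commute)
      also have "\<dots> = I ?a u"
        unfolding I_def
        by (rule nn_integral_cong_AE) (use elim(1) in eventually_elim, simp add: indicator_def)
      finally show ?thesis .
    qed
    from 1 2 show ?case by blast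
  qed
  have good: "AE \<omega> in \<Omega>. M 0 \<omega> \<in> Good"
  proof -
    have "AE \<omega> in \<Omega>. M 0 \<omega> \<in> Good \<longleftrightarrow> M 1 \<omega> \<in> Good"
      using shift AE_space
    proof eventually_elim
      case (elim \<omega>)
      then show ?case using measurable_space[OF M] by (auto simp: Good_def)
    qed
    from ergodic[OF _ this] have "(AE \<omega> in \<Omega>. M 0 \<omega> \<in> Good) \<or> (AE \<omega> in \<Omega>. M 0 \<omega> \<notin> Good)"
      by measurable
    moreover have "\<not> (AE \<omega> in \<Omega>. M 0 \<omega> \<notin> Good)"
    proof
      assume "AE \<omega> in \<Omega>. M 0 \<omega> \<notin> Good"
      then have "AE \<omega> in \<Omega>. (\<integral>\<^sup>+s. ennreal ((h (M 0 \<omega>, s))\<^sup>2) \<partial>lborel) = 0"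
        using fin AE_space
      proof eventually_elim
        case (elim \<omega>)
        then show ?case using measurable_space[OF M elim(3)] by (auto simp: Good_def N_def not_gr_zero)
      qed
      with nonzero show False by blast
    qed
    ultimately show ?thesis by blast
  qed
  define \<xi> where "\<xi> a = (if a \<in> Good then lower_median (\<mu> a) else 0)" for a
  have \<xi>: "\<xi> \<in> borel_measurable S"
    unfolding borel_measurable_iff_less
  proof
    fix c
    define E where "E q = {a \<in> space S. enn2real (N a) \<le> 2 * enn2real (I a (of_rat q))}" for q :: rat
    have N_real: "(\<lambda>a. enn2real (N a)) \<in> borel_measurable S"
      by (rule borel_measurable_enn2real[OF N])
    have I_real: "(\<lambda>a. 2 * enn2real (I a u)) \<in> borel_measurable S" for u
      by (intro borel_measurable_times borel_measurable_const borel_measurable_enn2real[OF I])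
    have [measurable]: "E q \<in> sets S" for q
      unfolding E_def by (rule borel_measurable_le[OF N_real I_real])
    have "{a \<in> space S. \<xi> a < c}
      = (\<Union>q\<in>{q. of_rat q < c}. Good \<inter> E q) \<union> (if 0 < c then space S - Good else {})"
      using lower_median_less_iff[OF \<mu> pos] by (auto simp: \<xi>_def \<mu>_I \<mu>_N E_def Good_space)
    also have "\<dots> \<in> sets S"
      by (intro sets.Un sets.countable_UN'') auto
    finally show "{a \<in> space S. \<xi> a < c} \<in> sets S" .
  qed
  have "AE \<omega> in \<Omega>. x 1 \<omega> = \<xi> (M 1 \<omega>) - \<xi> (M 0 \<omega>)"
    using shift good AE_space
  proof eventually_elim
    case (elim \<omega>)
    have s: "M 0 \<omega> \<in> space S" "M 1 \<omega> \<in> space S" using elim(3) measurable_space[OF M] by auto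
    have "M 1 \<omega> \<in> Good" using elim(1,2) s by (auto simp: Good_def)
    moreover have "lower_median (\<mu> (M 1 \<omega>)) = lower_median (\<mu> (M 0 \<omega>)) + x 1 \<omega>"
      using elim(1) s by (intro lower_median_shift[OF \<mu> pos] elim(2)) (simp_all only: \<mu>_I \<mu>_N)
    ultimately show ?case using elim(2) by (simp add: \<xi>_def)
  qed
  with \<xi> show ?thesis by blast
qed

end

section \<open>Stationary and ergodic sequences\<close>

lemma stationary_seqD:
  assumes "stationary_seq \<Omega> S Z"
  shows "Z n \<in> \<Omega> \<rightarrow>\<^sub>M S"
  using assms by (simp add: stationary_seq_def random_seq_def)

lemma random_seq_path_measurable:
  assumes "\<And>n. Z n \<in> \<Omega> \<rightarrow>\<^sub>M S"
  shows "(\<lambda>\<omega> n. Z (n + k) \<omega>) \<in> \<Omega> \<rightarrow>\<^sub>M (\<Pi>\<^sub>M n\<in>(UNIV :: int set). S)"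
  by (rule measurable_PiM_single') (use assms in \<open>auto dest: measurable_space\<close>)

lemma stationary_seq_distr:
  assumes Z: "stationary_seq \<Omega> S Z" and f: "f \<in> (\<Pi>\<^sub>M n\<in>UNIV. S) \<rightarrow>\<^sub>M N"
  shows "distr \<Omega> N (\<lambda>\<omega>. f (\<lambda>n. Z (n + k) \<omega>)) = distr \<Omega> N (\<lambda>\<omega>. f (\<lambda>n. Z n \<omega>))"
proof -
  let ?P = "\<Pi>\<^sub>M n\<in>(UNIV :: int set). S"
  have path: "(\<lambda>\<omega> n. Z (n + k) \<omega>) \<in> \<Omega> \<rightarrow>\<^sub>M ?P" for k
    by (rule random_seq_path_measurable[OF stationary_seqD[OF Z]])
  have "distr \<Omega> N (\<lambda>\<omega>. f (\<lambda>n. Z (n + k) \<omega>)) = distr (distr \<Omega> ?P (\<lambda>\<omega> n. Z (n + k) \<omega>)) N f" for k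
    using distr_distr[OF f path[of k]] by (simp add: comp_def)
  from this[of k] this[of 0] show ?thesis
    using Z by (simp add: stationary_seq_def)
qed

lemma stationary_seq_AE:
  assumes Z: "stationary_seq \<Omega> S Z" and \<Phi>: "Measurable.pred (\<Pi>\<^sub>M n\<in>UNIV. S) \<Phi>"
  shows "(AE \<omega> in \<Omega>. \<Phi> (\<lambda>n. Z (n + k) \<omega>)) \<longleftrightarrow> (AE \<omega> in \<Omega>. \<Phi> (\<lambda>n. Z n \<omega>))"
proof -
  have path: "(\<lambda>\<omega> n. Z (n + k) \<omega>) \<in> \<Omega> \<rightarrow>\<^sub>M (\<Pi>\<^sub>M n\<in>(UNIV :: int set). S)" for k
    by (rule random_seq_path_measurable[OF stationary_seqD[OF Z]])
  have m: "(\<lambda>\<omega>. \<Phi> (\<lambda>n. Z (n + k) \<omega>)) \<in> \<Omega> \<rightarrow>\<^sub>M count_space UNIV" for k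
    using path \<Phi> by (rule measurable_compose)
  have "(AE b in distr \<Omega> (count_space UNIV) (\<lambda>\<omega>. \<Phi> (\<lambda>n. Z (n + k) \<omega>)). b)
      \<longleftrightarrow> (AE \<omega> in \<Omega>. \<Phi> (\<lambda>n. Z (n + k) \<omega>))" for k
    by (subst AE_distr_iff[OF m]) auto
  from this[of k] this[of 0, unfolded add_0_right] show ?thesis
    unfolding stationary_seq_distr[OF Z \<Phi>, of k] by blast
qed

text \<open>
  A set of states that the chain almost surely neither enters nor leaves need not give a strictly
  shift invariant event through the coordinate at time 0. The event that all coordinates, past
  and future, lie in \<open>A\<close> is strictly invariant and differs from the former by a null set.
\<close>

lemma ergodic_seq_invariant_state:
  assumes "prob_space \<Omega>" and erg: "ergodic_seq \<Omega> S M" and A: "A \<in> sets S"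
    and step: "AE \<omega> in \<Omega>. M 0 \<omega> \<in> A \<longleftrightarrow> M 1 \<omega> \<in> A"
  shows "(AE \<omega> in \<Omega>. M 0 \<omega> \<in> A) \<or> (AE \<omega> in \<Omega>. M 0 \<omega> \<notin> A)"
proof -
  interpret prob_space \<Omega> by fact
  note [measurable] = A
  have stat: "stationary_seq \<Omega> S M" using erg by (simp add: ergodic_seq_def)
  let ?P = "\<Pi>\<^sub>M n\<in>(UNIV :: int set). S"
  have M [measurable]: "M n \<in> \<Omega> \<rightarrow>\<^sub>M S" for n by (rule stationary_seqD[OF stat])
  have path: "(\<lambda>\<omega> n. M n \<omega>) \<in> \<Omega> \<rightarrow>\<^sub>M ?P"
    using random_seq_path_measurable[of M \<Omega> S 0] M by simp
  have "Measurable.pred ?P (\<lambda>z. z 0 \<in> A \<longleftrightarrow> z 1 \<in> A)" by measurable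
  then have "AE \<omega> in \<Omega>. M (0 + n) \<omega> \<in> A \<longleftrightarrow> M (1 + n) \<omega> \<in> A" for n
    using stationary_seq_AE[OF stat, of "\<lambda>z. z 0 \<in> A \<longleftrightarrow> z 1 \<in> A" n] step by simp
  then have "AE \<omega> in \<Omega>. \<forall>n. M (0 + n) \<omega> \<in> A \<longleftrightarrow> M (1 + n) \<omega> \<in> A"
    by (subst AE_all_countable) blast
  then have const: "AE \<omega> in \<Omega>. M 0 \<omega> \<in> A \<longleftrightarrow> (\<forall>n. M n \<omega> \<in> A)"
  proof eventually_elim
    case (elim \<omega>)
    have "M n \<omega> \<in> A \<longleftrightarrow> M 0 \<omega> \<in> A" for n
    proof (induction n rule: int_induct[of _ 0])
      case (step1 i)
      then show ?case using elim[rule_format, of i] by (simp add: add.commute)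
    next
      case (step2 i)
      then show ?case using elim[rule_format, of "i - 1"] by simp
    qed simp
    then show ?case by blast
  qed
  define B where "B = {z \<in> space ?P. \<forall>n. z n \<in> A}"
  have B [measurable]: "B \<in> sets ?P" unfolding B_def by measurable
  have "{z \<in> space ?P. (\<lambda>n. z (n + 1)) \<in> B} = B"
  proof -
    have "(\<forall>n. z (n + 1) \<in> A) \<longleftrightarrow> (\<forall>n. z n \<in> A)" for z :: "int \<Rightarrow> _"
      by (metis diff_add_cancel)
    then show ?thesis by (auto simp: B_def space_PiM)
  qed
  with erg B have "measure (distr \<Omega> ?P (\<lambda>\<omega> n. M n \<omega>)) B \<in> {0, 1}"
    unfolding ergodic_seq_def by blast
  also have "measure (distr \<Omega> ?P (\<lambda>\<omega> n. M n \<omega>)) B = prob {\<omega> \<in> space \<Omega>. \<forall>n. M n \<omega> \<in> A}"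
    using measurable_space[OF path]
    by (subst measure_distr[OF path B]) (auto simp: B_def intro!: arg_cong[where f=prob])
  finally consider "prob {\<omega> \<in> space \<Omega>. \<forall>n. M n \<omega> \<in> A} = 0" | "prob {\<omega> \<in> space \<Omega>. \<forall>n. M n \<omega> \<in> A} = 1"
    by blast
  then show ?thesis
  proof cases
    case 1
    then have "AE \<omega> in \<Omega>. \<not> (\<forall>n. M n \<omega> \<in> A)"
      by (subst (asm) prob_eq_0) (auto elim!: eventually_mono AE_mp)
    then have "AE \<omega> in \<Omega>. M 0 \<omega> \<notin> A" using const by eventually_elim blast
    then show ?thesis ..
  next
    case 2
    then have "AE \<omega> in \<Omega>. \<forall>n. M n \<omega> \<in> A"
      by (subst (asm) prob_Collect_eq_1) auto
    then show ?thesis by (auto elim: eventually_mono)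
  qed
qed

section \<open>Tightness of coboundary walks\<close>

lemma random_walk_telescope:
  assumes "\<And>n. X n \<omega> = Y n \<omega> - Y (n - 1) \<omega>"
  shows "random_walk X n \<omega> = Y n \<omega> - Y 0 \<omega>"
proof (cases "0 \<le> n")
  case True
  then have "(\<Sum>i=1..n. X i \<omega>) = Y n \<omega> - Y 0 \<omega>"
  proof (induction n rule: int_ge_induct)
    case (step i)
    have "{1..i + 1} = insert (i + 1) {1..i}" using step.hyps by auto
    then show ?case using step.IH assms[of "i + 1"] by simp
  qed simp
  then show ?thesis using True by (simp add: random_walk_def)
next
  case False
  then have "n \<le> 0" by simp
  then have "(\<Sum>i=n+1..0. X i \<omega>) = Y 0 \<omega> - Y n \<omega>"
  proof (induction n rule: int_le_induct)
    case (step i)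
    have "{i - 1 + 1..0} = insert i {i + 1..0}" using step.hyps by auto
    then show ?case using step.IH assms[of i] by simp
  qed simp
  then show ?thesis using False by (simp add: random_walk_def)
qed

lemma random_walk_measurable:
  fixes X :: "int \<Rightarrow> 'w \<Rightarrow> real ^ 'd"
  assumes [measurable]: "\<And>n. X n \<in> borel_measurable \<Omega>"
  shows "random_walk X n \<in> borel_measurable \<Omega>"
  unfolding random_walk_def[abs_def] by (cases "0 \<le> n") simp_all

text \<open>
  The walk equals \<open>Y\<^sub>n - Y\<^sub>0\<close>, so it leaves the ball of radius \<open>2 m\<close> only if one of two vectors with
  the same law leaves the ball of radius \<open>m\<close>.
\<close>

lemma coboundary_walk_tight:
  fixes X :: "int \<Rightarrow> 'w \<Rightarrow> real ^ 'd"
  assumes "prob_space \<Omega>" and X: "\<And>n. X n \<in> borel_measurable \<Omega>" and Y: "coboundary_seq \<Omega> X Y"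
  shows "tight_family \<Omega> UNIV (random_walk X)"
  unfolding tight_family_def tight_laws_def
proof (intro allI impI)
  interpret prob_space \<Omega> by fact
  have stat: "stationary_seq \<Omega> borel Y" using Y by (simp add: coboundary_seq_def)
  have [measurable]: "Y n \<in> borel_measurable \<Omega>" for n by (rule stationary_seqD[OF stat])
  note [measurable] = random_walk_measurable[OF X]
  have law_Y: "distr \<Omega> borel (Y n) = distr \<Omega> borel (Y 0)" for n
    using stationary_seq_distr[OF stat, of "\<lambda>z. z 0" borel n] by simp
  have "AE \<omega> in \<Omega>. \<forall>n. X n \<omega> = Y n \<omega> - Y (n - 1) \<omega>"
    using Y unfolding coboundary_seq_def by (subst AE_all_countable) blast
  then have walk: "AE \<omega> in \<Omega>. \<forall>n. random_walk X n \<omega> = Y n \<omega> - Y 0 \<omega>"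
    by eventually_elim (blast intro: random_walk_telescope)
  fix \<epsilon> :: real assume "0 < \<epsilon>"
  define B where "B m = {\<omega> \<in> space \<Omega>. real m < norm (Y 0 \<omega>)}" for m
  have "(\<lambda>m. prob (B m)) \<longlonglongrightarrow> prob (\<Inter>m. B m)"
    by (rule finite_Lim_measure_decseq) (auto simp: B_def decseq_def)
  moreover have "(\<Inter>m. B m) = {}"
    by (auto simp: B_def) (meson not_less_iff_gr_or_eq reals_Archimedean2)
  ultimately have "(\<lambda>m. prob (B m)) \<longlonglongrightarrow> 0" by simp
  from order_tendstoD(2)[OF this, of "\<epsilon> / 2"] obtain m where m: "prob (B m) < \<epsilon> / 2"
    using \<open>0 < \<epsilon>\<close> by (auto simp: eventually_sequentially)
  let ?K = "cball (0 :: real ^ 'd) (2 * real m)"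
  have "measure (distr \<Omega> borel (random_walk X n)) (- ?K) < \<epsilon>" for n
  proof -
    have tail: "prob {\<omega> \<in> space \<Omega>. real m < norm (Y n \<omega>)} = prob (B m)" for n
    proof -
      have "measure (distr \<Omega> borel (Y n)) {y. real m < norm y} = prob (Y n -` {y. real m < norm y} \<inter> space \<Omega>)" for n
        by (rule measure_distr) measurable
      moreover have "Y n -` {y. real m < norm y} \<inter> space \<Omega> = {\<omega> \<in> space \<Omega>. real m < norm (Y n \<omega>)}" for n
        by auto
      ultimately show ?thesis by (metis law_Y B_def)
    qed
    have "measure (distr \<Omega> borel (random_walk X n)) (- ?K) = prob {\<omega> \<in> space \<Omega>. 2 * real m < norm (random_walk X n \<omega>)}"
      by (subst measure_distr) (auto intro!: arg_cong[where f=prob])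
    also have "\<dots> \<le> prob ({\<omega> \<in> space \<Omega>. real m < norm (Y n \<omega>)} \<union> B m)"
    proof (rule finite_measure_mono_AE)
      show "AE \<omega> in \<Omega>. \<omega> \<in> {\<omega> \<in> space \<Omega>. 2 * real m < norm (random_walk X n \<omega>)} \<longrightarrow>
          \<omega> \<in> {\<omega> \<in> space \<Omega>. real m < norm (Y n \<omega>)} \<union> B m"
        using walk
      proof eventually_elim
        case (elim \<omega>)
        then have "norm (random_walk X n \<omega>) \<le> norm (Y n \<omega>) + norm (Y 0 \<omega>)"
          by (simp add: norm_triangle_ineq4)
        then show ?case by (auto simp: B_def)
      qed
    qed (auto simp: B_def)
    also have "\<dots> \<le> prob {\<omega> \<in> space \<Omega>. real m < norm (Y n \<omega>)} + prob (B m)"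
      by (rule measure_Un_le) (auto simp: B_def)
    also have "\<dots> < \<epsilon>" using m unfolding tail by simp
    finally show ?thesis .
  qed
  then show "\<exists>K. compact K \<and> (\<forall>\<mu>\<in>(\<lambda>i. distr \<Omega> borel (random_walk X i)) ` UNIV. measure \<mu> (- K) < \<epsilon>)"
    by (intro exI[of _ ?K]) auto
qed

section \<open>Equivalence of tightness and null homology\<close>

text \<open>
  Events that concern a coordinate of \<open>X\<close> are preimages of events that concern \<open>X\<close>; the increment kernel of the
  coordinate is the image of that of \<open>X\<close>.
\<close>

lemma markov_modulated_component:
  fixes X :: "int \<Rightarrow> 'w \<Rightarrow> real ^ 'd"
  assumes "prob_space \<Omega>" and mm: "markov_modulated \<Omega> S M X"
  obtains Q P where "modulated_walk \<Omega> S M (\<lambda>n \<omega>. X n \<omega> $ j) Q P"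
proof -
  have pair: "(\<lambda>\<omega>. (M n \<omega>, X n \<omega>)) \<in> \<Omega> \<rightarrow>\<^sub>M S \<Otimes>\<^sub>M borel" for n
    using mm stationary_seqD[of \<Omega> "S \<Otimes>\<^sub>M borel" "\<lambda>n \<omega>. (M n \<omega>, X n \<omega>)"] by (simp add: markov_modulated_def)
  have M: "M n \<in> \<Omega> \<rightarrow>\<^sub>M S" for n using measurable_compose[OF pair measurable_fst, of n] by simp
  have X [measurable]: "X n \<in> borel_measurable \<Omega>" for n using measurable_compose[OF pair measurable_snd, of n] by simp
  let ?F = "generated_by \<Omega> S M UNIV"
  let ?c = "\<lambda>v :: real ^ 'd. v $ j"
  have c [measurable]: "?c \<in> borel_measurable borel" by (intro borel_measurable_continuous_onI continuous_intros)
  have c_sets: "?c -` B \<in> sets borel" if "B \<in> sets borel" for B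
    using measurable_sets[OF c that] by simp
  obtain Q where Q: "Q \<in> S \<rightarrow>\<^sub>M prob_algebra S"
    "\<forall>n. \<forall>B\<in>sets S. AE \<omega> in \<Omega>. cond_probability \<Omega> (generated_by \<Omega> S M {..n}) {\<omega> \<in> space \<Omega>. M (n + 1) \<omega> \<in> B} \<omega>
        = measure (Q (M n \<omega>)) B"
    using mm unfolding markov_modulated_def homogeneous_markov_chain_def by blast
  obtain P where P: "P \<in> (S \<Otimes>\<^sub>M S) \<rightarrow>\<^sub>M prob_algebra borel"
    "\<forall>n. \<forall>B\<in>sets borel. AE \<omega> in \<Omega>. cond_probability \<Omega> ?F {\<omega> \<in> space \<Omega>. X n \<omega> \<in> B} \<omega>
        = measure (P (M (n - 1) \<omega>, M n \<omega>)) B"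
    using mm unfolding markov_modulated_def by blast
  have indep: "cond_indep_seq \<Omega> ?F borel X"
    using mm by (simp add: markov_modulated_def)
  define P' where "P' p = distr (P p) borel ?c" for p
  have "modulated_walk \<Omega> S M (\<lambda>n \<omega>. X n \<omega> $ j) Q P'"
  proof (unfold modulated_walk_def modulated_walk_axioms_def, intro conjI allI impI)
    show "prob_space \<Omega>" by fact
    show "M n \<in> \<Omega> \<rightarrow>\<^sub>M S" for n by (rule M)
    show "(\<lambda>\<omega>. X n \<omega> $ j) \<in> borel_measurable \<Omega>" for n by measurable
    show "Q \<in> S \<rightarrow>\<^sub>M prob_algebra S" by (rule Q(1))
    show "AE \<omega> in \<Omega>. cond_probability \<Omega> (generated_by \<Omega> S M {..n}) {\<omega> \<in> space \<Omega>. M (n + 1) \<omega> \<in> B} \<omega>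
        = measure (Q (M n \<omega>)) B" if "B \<in> sets S" for n B
      using Q(2) that by blast
    show "P' \<in> S \<Otimes>\<^sub>M S \<rightarrow>\<^sub>M prob_algebra borel"
      unfolding P'_def[abs_def] by (rule measurable_compose[OF P(1) measurable_distr_prob_space[OF c]])
    show "cond_indep_seq \<Omega> ?F borel (\<lambda>n \<omega>. X n \<omega> $ j)"
      unfolding cond_indep_seq_def
    proof (intro allI impI)
      fix J :: "int set" and B :: "int \<Rightarrow> real set"
      assume "finite J" "\<forall>n\<in>J. B n \<in> sets borel"
      then show "AE \<omega> in \<Omega>. cond_probability \<Omega> ?F {\<omega> \<in> space \<Omega>. \<forall>n\<in>J. X n \<omega> $ j \<in> B n} \<omega>
          = (\<Prod>n\<in>J. cond_probability \<Omega> ?F {\<omega> \<in> space \<Omega>. X n \<omega> $ j \<in> B n} \<omega>)"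
        using indep[unfolded cond_indep_seq_def, rule_format, of J "\<lambda>n. ?c -` B n"] c_sets by simp
    qed
    show "AE \<omega> in \<Omega>. cond_probability \<Omega> ?F {\<omega> \<in> space \<Omega>. X n \<omega> $ j \<in> B} \<omega>
        = measure (P' (M (n - 1) \<omega>, M n \<omega>)) B" if B: "B \<in> sets borel" for n B
      using P(2)[rule_format, OF c_sets[OF B], of n] AE_space
    proof eventually_elim
      case (elim \<omega>)
      have "(M (n - 1) \<omega>, M n \<omega>) \<in> space (S \<Otimes>\<^sub>M S)"
        using measurable_space[OF M elim(2)] by (simp add: space_pair_measure)
      from measurable_space[OF P(1) this] have s: "sets (P (M (n - 1) \<omega>, M n \<omega>)) = sets borel"
        by (simp add: space_prob_algebra)
      have "?c \<in> P (M (n - 1) \<omega>, M n \<omega>) \<rightarrow>\<^sub>M borel"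
        unfolding measurable_cong_sets[OF s refl] by (rule c)
      from measure_distr[OF this B] show ?case
        using elim(1) sets_eq_imp_space_eq[OF s] by (simp add: P'_def)
    qed
  qed
  then show thesis by (rule that)
qed

text \<open>
  By joint stationarity a representation of one increment by the chain holds at all times, negative ones
  included.
\<close>

lemma increment_identity_shift:
  fixes X :: "int \<Rightarrow> 'w \<Rightarrow> real ^ 'd"
  assumes stat: "stationary_seq \<Omega> (S \<Otimes>\<^sub>M borel) (\<lambda>n \<omega>. (M n \<omega>, X n \<omega>))"
    and g [measurable]: "g \<in> S \<Otimes>\<^sub>M S \<rightarrow>\<^sub>M borel"
    and eq: "AE \<omega> in \<Omega>. X m \<omega> = g (M (m - 1) \<omega>, M m \<omega>)"
  shows "AE \<omega> in \<Omega>. X n \<omega> = g (M (n - 1) \<omega>, M n \<omega>)"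
proof -
  let ?\<Phi> = "\<lambda>z :: int \<Rightarrow> _. snd (z 0) = g (fst (z (-1)), fst (z 0))"
  have [measurable]: "(\<lambda>z. z i) \<in> (\<Pi>\<^sub>M n\<in>(UNIV :: int set). S \<Otimes>\<^sub>M borel) \<rightarrow>\<^sub>M S \<Otimes>\<^sub>M (borel :: (real ^ 'd) measure)" for i
    by (rule measurable_component_singleton) simp
  have "Measurable.pred (\<Pi>\<^sub>M n\<in>UNIV. S \<Otimes>\<^sub>M borel) (\<lambda>z :: int \<Rightarrow> _. norm (snd (z 0) - g (fst (z (-1)), fst (z 0))) = 0)"
    by measurable
  then have "Measurable.pred (\<Pi>\<^sub>M n\<in>UNIV. S \<Otimes>\<^sub>M borel) ?\<Phi>" by simp
  from stationary_seq_AE[OF stat this, of m] stationary_seq_AE[OF stat this, of n] eq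
  show ?thesis by simp
qed

lemma tight_walk_strict_null_homologous:
  fixes S :: "'s measure" and X :: "int \<Rightarrow> 'w \<Rightarrow> real ^ 'd"
  assumes "prob_space \<Omega>" and mm: "markov_modulated \<Omega> S M X" and erg: "ergodic_seq \<Omega> S M"
    and tight: "tight_family \<Omega> {0..} (random_walk X)"
  shows "strict_null_homologous \<Omega> S M X"
proof -
  interpret prob_space \<Omega> by fact
  have stat: "stationary_seq \<Omega> (S \<Otimes>\<^sub>M borel) (\<lambda>n \<omega>. (M n \<omega>, X n \<omega>))"
    using mm by (simp add: markov_modulated_def)
  have stat_M: "stationary_seq \<Omega> S M" using erg by (simp add: ergodic_seq_def)
  have M [measurable]: "M n \<in> \<Omega> \<rightarrow>\<^sub>M S" for n by (rule stationary_seqD[OF stat_M])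
  have X [measurable]: "X n \<in> borel_measurable \<Omega>" for n
    using measurable_compose[OF stationary_seqD[OF stat] measurable_snd, of n] by simp
  have law_M: "distr \<Omega> S (M 1) = distr \<Omega> S (M 0)"
    using stationary_seq_distr[OF stat_M, of "\<lambda>z. z 0" S 1] by simp
  obtain C where C: "compact C" "\<And>n. 0 \<le> n \<Longrightarrow> measure (distr \<Omega> borel (random_walk X n)) (- C) < 1/2"
    using tight unfolding tight_family_def tight_laws_def
    by (auto dest!: spec[of _ "1/2 :: real"])
  obtain R where R: "0 < R" "\<And>v. v \<in> C \<Longrightarrow> norm v \<le> R"
    using compact_imp_bounded[OF C(1)] unfolding bounded_pos by blast
  have "\<exists>\<xi> \<in> borel_measurable S. AE \<omega> in \<Omega>. X 1 \<omega> $ j = \<xi> (M 1 \<omega>) - \<xi> (M 0 \<omega>)" for j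
  proof -
    obtain Q P where "modulated_walk \<Omega> S M (\<lambda>n \<omega>. X n \<omega> $ j) Q P"
      by (rule markov_modulated_component[OF \<open>prob_space \<Omega>\<close> mm])
    then interpret W: modulated_walk \<Omega> S M "\<lambda>n \<omega>. X n \<omega> $ j" Q P .
    have T: "W.T k \<omega> = random_walk X (int k) \<omega> $ j" for k \<omega>
      by (simp add: W.T_def random_walk_def)
    show ?thesis
    proof (rule W.increment_is_coboundary[OF law_M _ less_imp_le[OF R(1)]])
      show "(AE \<omega> in \<Omega>. M 0 \<omega> \<in> A) \<or> (AE \<omega> in \<Omega>. M 0 \<omega> \<notin> A)"
        if "A \<in> sets S" "AE \<omega> in \<Omega>. M 0 \<omega> \<in> A \<longleftrightarrow> M 1 \<omega> \<in> A" for A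
        by (rule ergodic_seq_invariant_state[OF \<open>prob_space \<Omega>\<close> erg that])
      show "prob {\<omega> \<in> space \<Omega>. R < \<bar>W.T k \<omega>\<bar>} \<le> 1/2" for k
      proof -
        note [measurable] = random_walk_measurable[OF X]
        have [measurable]: "- C \<in> sets borel" using compact_imp_closed[OF C(1)] by auto
        have "R < \<bar>v $ j\<bar> \<Longrightarrow> v \<in> - C" for v
          using R(2)[of v] component_le_norm_cart[of v j] by auto
        then have "prob {\<omega> \<in> space \<Omega>. R < \<bar>W.T k \<omega>\<bar>} \<le> prob (random_walk X (int k) -` (- C) \<inter> space \<Omega>)"
          unfolding T by (intro finite_measure_mono) auto
        also have "\<dots> = measure (distr \<Omega> borel (random_walk X (int k))) (- C)"
          by (subst measure_distr) auto
        also have "\<dots> \<le> 1/2" using C(2)[of "int k"] by simp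
        finally show ?thesis .
      qed
    qed
  qed
  then obtain \<xi>' :: "'d \<Rightarrow> 's \<Rightarrow> real" where \<xi>' [measurable]: "\<And>j. \<xi>' j \<in> borel_measurable S"
    and inc: "\<And>j. AE \<omega> in \<Omega>. X 1 \<omega> $ j = \<xi>' j (M 1 \<omega>) - \<xi>' j (M 0 \<omega>)"
    by metis
  define \<xi> :: "'s \<Rightarrow> real ^ 'd" where "\<xi> a = (\<chi> j. \<xi>' j a)" for a
  have \<xi> [measurable]: "\<xi> \<in> borel_measurable S"
  proof -
    have "(\<lambda>a. \<xi> a \<bullet> b) \<in> borel_measurable S" if "b \<in> Basis" for b
      using that by (auto simp: \<xi>_def Basis_vec_def inner_axis)
    then show ?thesis by (simp add: borel_measurable_euclidean_space[of \<xi>])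
  qed
  have "AE \<omega> in \<Omega>. \<forall>j\<in>UNIV. X 1 \<omega> $ j = \<xi>' j (M 1 \<omega>) - \<xi>' j (M 0 \<omega>)"
    using inc by (intro AE_finite_allI) auto
  then have X_1: "AE \<omega> in \<Omega>. X 1 \<omega> = \<xi> (M 1 \<omega>) - \<xi> (M 0 \<omega>)"
    by eventually_elim (simp add: vec_eq_iff \<xi>_def)
  have g: "(\<lambda>(a, b). \<xi> b - \<xi> a) \<in> S \<Otimes>\<^sub>M S \<rightarrow>\<^sub>M borel" by measurable
  have X_n: "AE \<omega> in \<Omega>. X n \<omega> = \<xi> (M n \<omega>) - \<xi> (M (n - 1) \<omega>)" for n
    using increment_identity_shift[OF stat g, of 1 n] X_1 by simp
  have "stationary_seq \<Omega> borel (\<lambda>n \<omega>. \<xi> (M n \<omega>))"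
  proof -
    have "(\<lambda>z n. \<xi> (z n)) \<in> (\<Pi>\<^sub>M n\<in>(UNIV :: int set). S) \<rightarrow>\<^sub>M (\<Pi>\<^sub>M n\<in>UNIV. borel)"
      by (rule measurable_PiM_single') auto
    from stationary_seq_distr[OF stat_M this] show ?thesis
      by (simp add: stationary_seq_def random_seq_def)
  qed
  with X_n have "coboundary_seq \<Omega> X (\<lambda>n \<omega>. \<xi> (M n \<omega>))"
    by (simp add: coboundary_seq_def)
  then show ?thesis
    unfolding strict_null_homologous_def by (intro exI[of _ "\<lambda>n \<omega>. \<xi> (M n \<omega>)"]) (auto intro!: bexI[OF _ \<xi>])
qed

theorem theorem3p1:
  fixes \<Omega> :: "'w measure" and S :: "'s measure"
    and M :: "int \<Rightarrow> 'w \<Rightarrow> 's" and X :: "int \<Rightarrow> 'w \<Rightarrow> real ^ 'd"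
  assumes "prob_space \<Omega>"
    and "markov_modulated \<Omega> S M X"
    and "ergodic_seq \<Omega> S M"
  shows "(strict_null_homologous \<Omega> S M X \<longleftrightarrow>
            null_homologous \<Omega> X \<and>
            (\<exists>g \<in> (S \<Otimes>\<^sub>M S) \<rightarrow>\<^sub>M borel. \<forall>n. AE \<omega> in \<Omega>. X n \<omega> = g (M (n - 1) \<omega>, M n \<omega>)))
       \<and> (null_homologous \<Omega> X \<and>
            (\<exists>g \<in> (S \<Otimes>\<^sub>M S) \<rightarrow>\<^sub>M borel. \<forall>n. AE \<omega> in \<Omega>. X n \<omega> = g (M (n - 1) \<omega>, M n \<omega>))
          \<longleftrightarrow> null_homologous \<Omega> X)
       \<and> (null_homologous \<Omega> X \<longleftrightarrow> tight_family \<Omega> UNIV (random_walk X))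
       \<and> (tight_family \<Omega> UNIV (random_walk X) \<longleftrightarrow> tight_family \<Omega> {0..} (random_walk X))"
    (is "(?a \<longleftrightarrow> ?c \<and> ?g) \<and> _ \<and> (_ \<longleftrightarrow> ?d) \<and> (_ \<longleftrightarrow> ?e)")
proof -
  have stat: "stationary_seq \<Omega> (S \<Otimes>\<^sub>M borel) (\<lambda>n \<omega>. (M n \<omega>, X n \<omega>))"
    using assms(2) by (simp add: markov_modulated_def)
  have X: "X n \<in> borel_measurable \<Omega>" for n
    using measurable_compose[OF stationary_seqD[OF stat] measurable_snd, of n] by simp
  have ab: "?c \<and> ?g" if ?a
  proof -
    obtain Y \<xi> where Y: "coboundary_seq \<Omega> X Y" and \<xi> [measurable]: "\<xi> \<in> S \<rightarrow>\<^sub>M borel"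
      and Y_\<xi>: "\<forall>n\<ge>0. AE \<omega> in \<Omega>. Y n \<omega> = \<xi> (M n \<omega>)"
      using \<open>?a\<close> unfolding strict_null_homologous_def by blast
    let ?g' = "\<lambda>(a, b). \<xi> b - \<xi> a"
    have g: "?g' \<in> S \<Otimes>\<^sub>M S \<rightarrow>\<^sub>M borel" by measurable
    have "AE \<omega> in \<Omega>. X 1 \<omega> = Y 1 \<omega> - Y (1 - 1) \<omega>"
      using Y unfolding coboundary_seq_def by blast
    moreover have "AE \<omega> in \<Omega>. Y 1 \<omega> = \<xi> (M 1 \<omega>)" "AE \<omega> in \<Omega>. Y 0 \<omega> = \<xi> (M 0 \<omega>)"
      using Y_\<xi> by simp_all
    ultimately have "AE \<omega> in \<Omega>. X 1 \<omega> = ?g' (M (1 - 1) \<omega>, M 1 \<omega>)"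
      by eventually_elim simp
    from increment_identity_shift[OF stat g this] Y g show ?thesis
      unfolding null_homologous_def by blast
  qed
  have cd: "?d" if ?c
  proof -
    obtain Y where "coboundary_seq \<Omega> X Y" using \<open>?c\<close> unfolding null_homologous_def ..
    with assms(1) X show ?thesis by (rule coboundary_walk_tight)
  qed
  have de: "?e" if ?d
    unfolding tight_family_def tight_laws_def
  proof (intro allI impI)
    fix \<epsilon> :: real assume "0 < \<epsilon>"
    then obtain K where "compact K"
      "\<forall>\<mu>\<in>(\<lambda>i. distr \<Omega> borel (random_walk X i)) ` UNIV. measure \<mu> (- K) < \<epsilon>"
      using \<open>?d\<close> unfolding tight_family_def tight_laws_def by metis
    then show "\<exists>K. compact K \<and> (\<forall>\<mu>\<in>(\<lambda>i. distr \<Omega> borel (random_walk X i)) ` {0..}. measure \<mu> (- K) < \<epsilon>)"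
      by (intro exI[of _ K]) auto
  qed
  have ea: "?a" if ?e
    by (rule tight_walk_strict_null_homologous[OF assms that])
  from ab cd de ea show ?thesis by blast
qed

end
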